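(* Consider the sparse Gaussian process state-space model with inducing outputs $\vec{\mathbf u}$, latent states $\mathbf x_t\in\mathbb R^{d_x}$ and observations $\mathbf y_t\in\mathbb R^{d_y}$, whose joint density is $$p(\vec{\mathbf u},\mathbf x_{0:T},\mathbf y_{1:T})=p(\mathbf x_0)\,p(\vec{\mathbf u})\prod_{t=1}^T p(\mathbf y_t\mid\mathbf x_t)\,p(\mathbf x_t\mid\vec{\mathbf u},\mathbf x_{t-1}).$$ For every $t\in\{1,\dots,T\}$, the log-likelihood $\log p(\mathbf y_t\mid\vec{\mathbf u},\mathbf y_{1:t-1})$ is the difference between the data reconstruction term $\mathbb E_{p(\mathbf x_t\mid\vec{\mathbf u},\mathbf y_{1:t})}[\log p(\mathbf y_t\mid\mathbf x_t)]$ and the KL divergence between the filtering distribution $p(\mathbf x_t\mid\vec{\mathbf u},\mathbf y_{1:t})$ and the prediction distribution $p(\mathbf x_t\mid\vec{\mathbf u},\mathbf y_{1:t-1})$: $$\log p(\mathbf y_t\mid\vec{\mathbf u},\mathbf y_{1:t-1})=-\operatorname{KL}\left[p(\mathbf x_t\mid\vec{\mathbf u},\mathbf y_{1:t})\,\|\,p(\mathbf x_t\mid\vec{\mathbf u},\mathbf y_{1:t-1})\right]+\mathbb E_{p(\mathbf x_t\mid\vec{\mathbf u},\mathbf y_{1:t})}\left[\log p(\mathbf y_t\mid\mathbf x_t)\right].$$ Consequently, for a variational density $q(\vec{\mathbf u})$, the online objective $$L_{\ell_t}=\mathbb E_{q(\vec{\mathbf u})}\left[\log p(\mathbf y_t\mid\vec{\mathbf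 u},\mathbf y_{1:t-1})\right]-\operatorname{KL}[q(\vec{\mathbf u})\,\|\,p(\vec{\mathbf u})]$$ can be expressed as $$L_{\ell_t}=\mathbb E_{q(\vec{\mathbf u})}\left[\mathbb E_{p(\mathbf x_t\mid\vec{\mathbf u},\mathbf y_{1:t})}[\log p(\mathbf y_t\mid\mathbf x_t)]\right]-\mathbb E_{q(\vec{\mathbf u})}\left[\operatorname{KL}\left[p(\mathbf x_t\mid\vec{\mathbf u},\mathbf y_{1:t})\,\|\,p(\mathbf x_t\mid\vec{\mathbf u},\mathbf y_{1:t-1})\right]\right]-\operatorname{KL}[q(\vec{\mathbf u})\,\|\,p(\vec{\mathbf u})].$$
   Context: Model. The transition function $f:\mathbb R^{d_x}\to\mathbb R^{d_x}$ has a zero-mean Gaussian process prior with $d_x$ mutually independent output components and given kernels. For fixed inducing inputs $\mathbf z_1,\dots,\mathbf z_M\in\mathbb R^{d_x}$, $\vec{\mathbf u}=(f(\mathbf z_1),\dots,f(\mathbf z_M))$ and $p(\vec{\mathbf u})$ is its Gaussian density under the GP prior. The transition density is $p(\mathbf x_t\mid\vec{\mathbf u},\mathbf x_{t-1})=\int \mathcal N(\mathbf x_t\mid\mathbf f_t,\mathbf Q)\,p(\mathbf f_t\mid\vec{\mathbf u},\mathbf x_{t-1})\,d\mathbf f_t$, where $p(\mathbf f_t\mid\vec{\mathbf u},\mathbf x_{t-1})$ is the Gaussian conditional law of $f(\mathbf x_{t-1})$ given $\vec{\mathbf u}$ under the GP prior. The emission density is $p(\mathbf y_t\mid\mathbf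 x_t)=\mathcal N(\mathbf y_t\mid\mathbf C\mathbf x_t,\mathbf R)$ with known $\mathbf C\in\mathbb R^{d_y\times d_x}$. The matrices $\mathbf Q,\mathbf R$ are (positive definite) covariance matrices, and $p(\mathbf x_0)$ is a Gaussian density. The variational density $q(\vec{\mathbf u})$ is Gaussian, $\mathcal N(\vec{\mathbf u}\mid\mathbf m,\mathbf S)$ with $\mathbf m\in\mathbb R^{Md_x}$ and $\mathbf S$ block diagonal with $d_x$ positive definite blocks of size $M\times M$ (one block per output dimension). Notation. $\mathbf y_{1:t}=(\mathbf y_1,\dots,\mathbf y_t)$ (empty for $t=0$). $p(\mathbf x_t\mid\vec{\mathbf u},\mathbf y_{1:t-1})$ (prediction distribution), $p(\mathbf x_t\mid\vec{\mathbf u},\mathbf y_{1:t})$ (filtering distribution) and $p(\mathbf y_t\mid\vec{\mathbf u},\mathbf y_{1:t-1})$ are the conditional densities derived from the joint density; in particular $p(\mathbf y_t\mid\vec{\mathbf u},\mathbf y_{1:t-1})=\int p(\mathbf y_t\mid\mathbf x_t)\,p(\mathbf x_t\mid\vec{\mathbf u},\mathbf y_{1:t-1})\,d\mathbf x_t$. $\operatorname{KL}[q\|p]=\mathbb E_q[\log(q/p)]$ is the Kullback–Leibler divergence. Expectations over $q(\vec{\mathbf u})$ are understood in the extended reals. *)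

theory Defs
  imports "HOL-Probability.Probability"
begin

section \<open>Gaussian densities and extended expectations\<close>

definition pos_def :: "real^'k^'k \<Rightarrow> bool" where
  "pos_def A \<longleftrightarrow> transpose A = A \<and> (\<forall>x. x \<noteq> 0 \<longrightarrow> x \<bullet> (A *v x) > 0)"

definition mvn_density :: "real^'k \<Rightarrow> real^'k^'k \<Rightarrow> real^'k \<Rightarrow> real" where
  "mvn_density \<mu> S x =
     exp (- ((x - \<mu>) \<bullet> (matrix_inv S *v (x - \<mu>))) / 2) / sqrt ((2 * pi) ^ CARD('k) * det S)"

definition density_measure :: "('a::euclidean_space \<Rightarrow> real) \<Rightarrow> 'a measure" where
  "density_measure p = density lborel (\<lambda>x. ennreal (p x))"

definition expect :: "('a::euclidean_space \<Rightarrow> real) \<Rightarrow> ('a \<Rightarrow> real) \<Rightarrow> real" where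
  "expect p g = (LINT x|density_measure p. g x)"

text \<open>The function \<^const>\<open>ennreal\<close> truncates negative numbers to \<open>0\<close>, so the two integrals are those
  of the positive and of the negative part of \<open>g\<close>.\<close>

definition ext_expect :: "('a::euclidean_space \<Rightarrow> real) \<Rightarrow> ('a \<Rightarrow> real) \<Rightarrow> ereal" where
  "ext_expect p g =
     enn2ereal (\<integral>\<^sup>+ x. ennreal (g x) \<partial>density_measure p)
     - enn2ereal (\<integral>\<^sup>+ x. ennreal (- g x) \<partial>density_measure p)"

text \<open>\<^const>\<open>KL_divergence\<close> integrates with respect to its last argument.\<close>

definition KL :: "('a::euclidean_space \<Rightarrow> real) \<Rightarrow> ('a \<Rightarrow> real) \<Rightarrow> real" where
  "KL q p = KL_divergence (exp 1) (density_measure p) (density_measure q)"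


section \<open>The sparse Gaussian process state-space model\<close>

text \<open>The index types \<open>'n\<close>, \<open>'m\<close>, \<open>'i\<close> have \<open>d\<^sub>x\<close>, \<open>d\<^sub>y\<close> and \<open>M\<close> elements. The inducing outputs are
  stacked into one vector \<open>u :: real^('n \<times> 'i)\<close> with \<open>u $ (d, i)\<close> the \<open>d\<close>-th component of
  \<open>f(z\<^sub>i)\<close>; \<open>kern G d\<close> is the prior covariance function of the \<open>d\<close>-th component of \<open>f\<close>.\<close>

record ('n, 'm, 'i) gpssm =
  kern :: "'n \<Rightarrow> real^'n \<Rightarrow> real^'n \<Rightarrow> real"
  inducing :: "'i \<Rightarrow> real^'n"
  trans_cov :: "real^'n^'n"
  emission_mat :: "real^'n^'m"
  emission_cov :: "real^'m^'m"
  init_mean :: "real^'n"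
  init_cov :: "real^'n^'n"

definition cov_kernel :: "('a \<Rightarrow> 'a \<Rightarrow> real) \<Rightarrow> bool" where
  "cov_kernel k \<longleftrightarrow> (\<forall>x y. k x y = k y x) \<and>
     (\<forall>A c. finite A \<longrightarrow> (\<Sum>x\<in>A. \<Sum>y\<in>A. c x * c y * k x y) \<ge> 0)"

definition Kzz :: "('n::finite, 'm::finite, 'i::finite) gpssm \<Rightarrow> 'n \<Rightarrow> real^'i^'i" where
  "Kzz G d = (\<chi> i j. kern G d (inducing G i) (inducing G j))"

definition kzx :: "('n::finite, 'm::finite, 'i::finite) gpssm \<Rightarrow> 'n \<Rightarrow> real^'n \<Rightarrow> real^'i" where
  "kzx G d x = (\<chi> i. kern G d (inducing G i) x)"

text \<open>Positive definiteness of \<open>Kzz G d\<close> says that the inducing outputs have a density under the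
  prior. Measurability of the kernels is what makes the transition density measurable in the
  previous state.\<close>

definition valid_gpssm :: "('n::finite, 'm::finite, 'i::finite) gpssm \<Rightarrow> bool" where
  "valid_gpssm G \<longleftrightarrow>
     (\<forall>d. cov_kernel (kern G d)) \<and>
     (\<forall>d. case_prod (kern G d) \<in> borel_measurable (borel \<Otimes>\<^sub>M borel)) \<and>
     (\<forall>d. pos_def (Kzz G d)) \<and>
     pos_def (trans_cov G) \<and> pos_def (emission_cov G) \<and> pos_def (init_cov G)"

definition block_diag :: "('n::finite \<Rightarrow> real^'i^'i) \<Rightarrow> real^('n \<times> 'i)^('n \<times> 'i)" where
  "block_diag B = (\<chi> a b. if fst a = fst b then B (fst a) $ snd a $ snd b else 0)"

definition prior_u :: "('n::finite, 'm::finite, 'i::finite) gpssm \<Rightarrow> real^('n \<times> 'i) \<Rightarrow> real" where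
  "prior_u G = mvn_density 0 (block_diag (Kzz G))"

text \<open>Gaussian conditioning of \<open>f(x)\<close> on the inducing outputs. The output components are independent,
  so the \<open>d\<close>-th component of \<open>f(x)\<close> depends only on the \<open>d\<close>-th components of the inducing outputs.
  The conditional variance vanishes at, for instance, the inducing inputs; the conditional law is
  therefore a measure, and \<open>normal_law \<mu> 0\<close> is the point mass at \<open>\<mu>\<close>.\<close>

definition normal_law :: "real \<Rightarrow> real \<Rightarrow> real measure" where
  "normal_law \<mu> v =
     distr (density lborel (\<lambda>e. ennreal (std_normal_density e))) borel (\<lambda>e. \<mu> + sqrt v * e)"

definition cond_mean ::
  "('n::finite, 'm::finite, 'i::finite) gpssm \<Rightarrow> real^('n \<times> 'i) \<Rightarrow> real^'n \<Rightarrow> 'n \<Rightarrow> real" where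
  "cond_mean G u x d = kzx G d x \<bullet> (matrix_inv (Kzz G d) *v (\<chi> i. u $ (d, i)))"

definition cond_var ::
  "('n::finite, 'm::finite, 'i::finite) gpssm \<Rightarrow> real^'n \<Rightarrow> 'n \<Rightarrow> real" where
  "cond_var G x d = kern G d x x - kzx G d x \<bullet> (matrix_inv (Kzz G d) *v kzx G d x)"

definition cond_law ::
  "('n::finite, 'm::finite, 'i::finite) gpssm \<Rightarrow> real^('n \<times> 'i) \<Rightarrow> real^'n \<Rightarrow> (real^'n) measure" where
  "cond_law G u x =
     distr (\<Pi>\<^sub>M d\<in>UNIV. normal_law (cond_mean G u x d) (cond_var G x d)) borel (\<lambda>g. \<chi> d. g d)"

definition trans_density ::
  "('n::finite, 'm::finite, 'i::finite) gpssm \<Rightarrow> real^('n \<times> 'i) \<Rightarrow> real^'n \<Rightarrow> real^'n \<Rightarrow> real" where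
  "trans_density G u x' x = (LINT f|cond_law G u x'. mvn_density f (trans_cov G) x)"

definition emission_density ::
  "('n::finite, 'm::finite, 'i::finite) gpssm \<Rightarrow> real^'n \<Rightarrow> real^'m \<Rightarrow> real" where
  "emission_density G x y = mvn_density (emission_mat G *v x) (emission_cov G) y"

definition init_density :: "('n::finite, 'm::finite, 'i::finite) gpssm \<Rightarrow> real^'n \<Rightarrow> real" where
  "init_density G = mvn_density (init_mean G) (init_cov G)"

text \<open>State paths are indexed by \<open>{0..T}\<close> and observation paths by \<open>{1..T}\<close>; values of the functions
  outside these ranges are ignored.\<close>

definition joint_density ::
  "('n::finite, 'm::finite, 'i::finite) gpssm \<Rightarrow> nat \<Rightarrow> real^('n \<times> 'i) \<Rightarrow>
     (nat \<Rightarrow> real^'n) \<Rightarrow> (nat \<Rightarrow> real^'m) \<Rightarrow> real" where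
  "joint_density G T u xs ys =
     init_density G (xs 0) * prior_u G u *
     (\<Prod>t=1..T. emission_density G (xs t) (ys t) * trans_density G u (xs (t - 1)) (xs t))"


section \<open>Conditional densities of the joint density\<close>

definition observe_upto :: "nat \<Rightarrow> (nat \<Rightarrow> 'a) \<Rightarrow> (nat \<Rightarrow> 'a) \<Rightarrow> nat \<Rightarrow> 'a" where
  "observe_upto s y ys = (\<lambda>i. if i \<le> s then y i else ys i)"

text \<open>\<open>p(u, y\<^sub>1\<^sub>:\<^sub>s)\<close> and \<open>p(u, x\<^sub>t = x, y\<^sub>1\<^sub>:\<^sub>s)\<close>: all other variables are integrated out.\<close>

definition marginal_y ::
  "('n::finite, 'm::finite, 'i::finite) gpssm \<Rightarrow> nat \<Rightarrow> nat \<Rightarrow> real^('n \<times> 'i) \<Rightarrow>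
     (nat \<Rightarrow> real^'m) \<Rightarrow> real" where
  "marginal_y G T s u y =
     (LINT ys|(\<Pi>\<^sub>M i\<in>{s<..T}. lborel). LINT xs|(\<Pi>\<^sub>M i\<in>{0..T}. lborel).
        joint_density G T u xs (observe_upto s y ys))"

definition marginal_xy ::
  "('n::finite, 'm::finite, 'i::finite) gpssm \<Rightarrow> nat \<Rightarrow> nat \<Rightarrow> nat \<Rightarrow> real^('n \<times> 'i) \<Rightarrow>
     (nat \<Rightarrow> real^'m) \<Rightarrow> real^'n \<Rightarrow> real" where
  "marginal_xy G T t s u y x =
     (LINT ys|(\<Pi>\<^sub>M i\<in>{s<..T}. lborel). LINT xs|(\<Pi>\<^sub>M i\<in>{0..T} - {t}. lborel).
        joint_density G T u (xs(t := x)) (observe_upto s y ys))"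

definition state_density ::
  "('n::finite, 'm::finite, 'i::finite) gpssm \<Rightarrow> nat \<Rightarrow> nat \<Rightarrow> nat \<Rightarrow> real^('n \<times> 'i) \<Rightarrow>
     (nat \<Rightarrow> real^'m) \<Rightarrow> real^'n \<Rightarrow> real" where
  "state_density G T t s u y x = marginal_xy G T t s u y x / marginal_y G T s u y"

definition filtering ::
  "('n::finite, 'm::finite, 'i::finite) gpssm \<Rightarrow> nat \<Rightarrow> nat \<Rightarrow> real^('n \<times> 'i) \<Rightarrow>
     (nat \<Rightarrow> real^'m) \<Rightarrow> real^'n \<Rightarrow> real" where
  "filtering G T t u y = state_density G T t t u y"

definition prediction ::
  "('n::finite, 'm::finite, 'i::finite) gpssm \<Rightarrow> nat \<Rightarrow> nat \<Rightarrow> real^('n \<times> 'i) \<Rightarrow>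
     (nat \<Rightarrow> real^'m) \<Rightarrow> real^'n \<Rightarrow> real" where
  "prediction G T t u y = state_density G T t (t - 1) u y"

text \<open>The predictive likelihood \<open>p(y\<^sub>t | u, y\<^sub>1\<^sub>:\<^sub>t\<^sub>-\<^sub>1)\<close>, evaluated at the entry \<open>y t\<close> of the path.\<close>

definition likelihood ::
  "('n::finite, 'm::finite, 'i::finite) gpssm \<Rightarrow> nat \<Rightarrow> nat \<Rightarrow> real^('n \<times> 'i) \<Rightarrow>
     (nat \<Rightarrow> real^'m) \<Rightarrow> real" where
  "likelihood G T t u y = marginal_y G T t u y / marginal_y G T (t - 1) u y"

text \<open>The log-likelihood is bounded above in \<open>u\<close>, so its extended expectation is never of the form
  \<open>\<infinity> - \<infinity>\<close>.\<close>

definition online_objective ::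
  "('n::finite, 'm::finite, 'i::finite) gpssm \<Rightarrow> nat \<Rightarrow> nat \<Rightarrow> (real^('n \<times> 'i) \<Rightarrow> real) \<Rightarrow>
     (nat \<Rightarrow> real^'m) \<Rightarrow> ereal" where
  "online_objective G T t q y =
     ext_expect q (\<lambda>u. ln (likelihood G T t u y)) - ereal (KL q (prior_u G))"

end

theory Submission
  imports Defs
begin

text \<open>
  Bayes' rule gives \<open>p(x\<^sub>t | u, y\<^sub>1\<^sub>:\<^sub>t) = p(y\<^sub>t | x\<^sub>t) p(x\<^sub>t | u, y\<^sub>1\<^sub>:\<^sub>t\<^sub>-\<^sub>1) / p(y\<^sub>t | u, y\<^sub>1\<^sub>:\<^sub>t\<^sub>-\<^sub>1)\<close> for almost every \<open>x\<^sub>t\<close>,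
  because the emission densities of the future observations integrate to one. Taking the logarithm
  of the ratio of filtering and prediction density and integrating against the filtering density
  yields the first identity; \<open>log p(y\<^sub>t | x\<^sub>t)\<close> is integrable there because the emission density \<open>a\<close> is
  bounded and hence so is \<open>a \<bar>log a\<bar>\<close>. For the second identity, the reconstruction term is bounded
  above and the divergence is nonnegative, so that the extended expectation of their difference
  splits.
\<close>

section \<open>Linear substitutions in Lebesgue integrals\<close>

text \<open>The marginals are iterated Bochner integrals, which take the value 0 when they diverge,
  so Fubini and the quotients of marginals are meaningful only once integrability is known. The
  proof therefore computes in \<open>ennreal\<close> and returns to the reals when the masses are
  known to be finite and positive: the emission factors are bounded by a constant free of states and
  observations, and the remaining chain of states has mass one. This rests on the normalisation of
  multivariate Gaussians, obtained by a linear substitution that turns the density into a product of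
  standard normal ones.

  A second difficulty is measurability in \<open>u\<close>, which the splitting of the expectation
  requires. The conditional law of \<open>f(x)\<close> may be degenerate; writing it as the image of
  a fixed standard normal vector moves all dependence on \<open>u\<close> and \<open>x\<close> into
  the integrand. The divergence is measurable in \<open>u\<close> because the first identity
  expresses it through the reconstruction term and the likelihood.\<close>

lemma borel_measurable_vec_nth [measurable (raw)]:
  fixes f :: "'a \<Rightarrow> real^'k"
  assumes "f \<in> borel_measurable M"
  shows "(\<lambda>x. f x $ i) \<in> borel_measurable M"
proof -
  have "(\<lambda>x. f x \<bullet> axis i 1) \<in> borel_measurable M"
    using assms by measurable
  then show ?thesis
    by (simp add: inner_axis)
qed

lemma borel_measurable_vec_lambda [measurable (raw)]:
  fixes f :: "'k::finite \<Rightarrow> 'a \<Rightarrow> real"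
  assumes "\<And>i. f i \<in> borel_measurable M"
  shows "(\<lambda>x. \<chi> i. f i x) \<in> borel_measurable M"
  using assms by (subst borel_measurable_euclidean_space) (auto simp: Basis_vec_def inner_axis)

lemma borel_measurable_matrix_vector_mult [measurable (raw)]:
  fixes f :: "'a \<Rightarrow> real^'k" and B :: "real^'k^'l"
  assumes [measurable]: "f \<in> borel_measurable M"
  shows "(\<lambda>x. B *v f x) \<in> borel_measurable M"
  unfolding matrix_vector_mult_def by measurable

lemma prod_Basis_vec:
  fixes g :: "real^'k \<Rightarrow> 'b::comm_monoid_mult"
  shows "(\<Prod>b\<in>Basis. g b) = (\<Prod>i\<in>UNIV. g (axis i 1))"
proof -
  have "inj (\<lambda>i. axis i 1 :: real^'k)"
    by (auto intro!: injI simp: axis_eq_axis)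
  moreover have "(Basis :: (real^'k) set) = range (\<lambda>i. axis i 1)"
    by (auto simp: Basis_vec_def)
  ultimately show ?thesis
    by (metis (no_types, lifting) prod.reindex_cong)
qed

interpretation lborel_prod: product_sigma_finite "\<lambda>_. lborel :: ('a::euclidean_space) measure"
  by standard

text \<open>Lebesgue measure is determined by the volumes of boxes, and a box pulls back to a
  product of intervals. This gives access to Fubini one coordinate at a time.\<close>

lemma lborel_vec_eq_distr_PiM:
  "(lborel :: (real^'k) measure) = distr (\<Pi>\<^sub>M i\<in>UNIV. lborel) borel (\<lambda>f. \<chi> i. f i)"
proof (rule lborel_eqI)
  fix l u :: "real^'k"
  assume le: "\<And>b. b \<in> Basis \<Longrightarrow> l \<bullet> b \<le> u \<bullet> b"
  then have le': "l $ i \<le> u $ i" for i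
    using le[of "axis i 1"] by (simp add: inner_axis axis_in_Basis_iff)
  have "(\<lambda>f. \<chi> i. f i) -` box l u \<inter> space (\<Pi>\<^sub>M i\<in>(UNIV::'k set). lborel)
      = (\<Pi>\<^sub>E i\<in>UNIV. {l $ i <..< u $ i})"
    by (auto simp: mem_box_cart space_PiM PiE_def Pi_iff)
  then show "emeasure (distr (\<Pi>\<^sub>M i\<in>UNIV. lborel) borel (\<lambda>f. \<chi> i. f i)) (box l u)
      = (\<Prod>b\<in>Basis. (u - l) \<bullet> b)"
    using le'
    by (subst emeasure_distr)
       (auto simp: lborel_prod.emeasure_PiM prod_Basis_vec inner_axis prod_ennreal)
qed simp

lemma nn_integral_lborel_vec:
  fixes g :: "real^'k \<Rightarrow> ennreal"
  assumes [measurable]: "g \<in> borel_measurable borel"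
  shows "(\<integral>\<^sup>+x. g x \<partial>lborel) = (\<integral>\<^sup>+f. g (\<chi> i. f i) \<partial>(\<Pi>\<^sub>M i\<in>UNIV. lborel))"
  by (subst lborel_vec_eq_distr_PiM) (simp add: nn_integral_distr)

lemma nn_integral_lborel_add:
  fixes g :: "'a::euclidean_space \<Rightarrow> ennreal"
  assumes [measurable]: "g \<in> borel_measurable borel"
  shows "(\<integral>\<^sup>+x. g (x + c) \<partial>lborel) = (\<integral>\<^sup>+x. g x \<partial>lborel)"
  by (subst (2) lborel_distr_plus[symmetric, of c]) (simp add: nn_integral_distr add.commute)

text \<open>With all coordinates except \<open>m\<close> held fixed, the shear is a translation of
  coordinate \<open>m\<close> by the constant \<open>x $ n\<close>; integrating coordinate
  \<open>m\<close> innermost reduces the claim to translation invariance.\<close>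

lemma nn_integral_lborel_shear:
  fixes g :: "real^'k \<Rightarrow> ennreal"
  assumes [measurable]: "g \<in> borel_measurable borel" and "m \<noteq> n"
  shows "(\<integral>\<^sup>+x. g (\<chi> i. if i = m then x $ m + x $ n else x $ i) \<partial>lborel) = (\<integral>\<^sup>+x. g x \<partial>lborel)"
proof -
  let ?P = "\<lambda>h. \<integral>\<^sup>+f. (\<integral>\<^sup>+x. h (f(m := x)) \<partial>lborel) \<partial>(\<Pi>\<^sub>M i\<in>UNIV - {m}. lborel)"
  have fubini_m: "(\<integral>\<^sup>+f. h f \<partial>(\<Pi>\<^sub>M i\<in>UNIV. lborel)) = ?P h"
    if "h \<in> borel_measurable (\<Pi>\<^sub>M i\<in>(UNIV :: 'k set). lborel)" for h :: "('k \<Rightarrow> real) \<Rightarrow> ennreal"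
    using lborel_prod.product_nn_integral_insert[of "UNIV - {m}" m h] that
    by (simp add: insert_absorb)
  have eq: "(\<chi> i. if i = m then (f(m := x)) m + (f(m := x)) n else (f(m := x)) i)
      = (\<chi> i. (f(m := x + f n)) i)" for f :: "'k \<Rightarrow> real" and x
    using \<open>m \<noteq> n\<close> by (auto simp: vec_eq_iff)
  have meas: "(\<lambda>x. g (\<chi> i. (f(m := x)) i)) \<in> borel_measurable borel" for f
  proof -
    have "(\<lambda>x. (f(m := x)) i) \<in> borel_measurable borel" for i
      by (cases "i = m") auto
    then show ?thesis by measurable
  qed
  have "(\<integral>\<^sup>+x. g (\<chi> i. if i = m then x $ m + x $ n else x $ i) \<partial>lborel)
      = ?P (\<lambda>f. g (\<chi> i. if i = m then f m + f n else f i))"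
    by (subst nn_integral_lborel_vec) (simp_all add: fubini_m del: fun_upd_apply cong: if_cong)
  also have "\<dots> = ?P (\<lambda>f. g (\<chi> i. f i))"
    unfolding eq by (rule nn_integral_cong, rule nn_integral_lborel_add[OF meas])
  also have "\<dots> = (\<integral>\<^sup>+x. g x \<partial>lborel)"
    by (subst nn_integral_lborel_vec) (simp_all add: fubini_m)
  finally show ?thesis .
qed

text \<open>The preimage of a box is the box with permuted end points, whose volume is the same
  product in another order.\<close>

lemma nn_integral_lborel_permute:
  fixes g :: "real^'k \<Rightarrow> ennreal"
  assumes [measurable]: "g \<in> borel_measurable borel" and p: "p permutes UNIV"
  shows "(\<integral>\<^sup>+x. g (\<chi> i. x $ p i) \<partial>lborel) = (\<integral>\<^sup>+x. g x \<partial>lborel)"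
proof -
  have "lborel = distr lborel borel (\<lambda>x :: real^'k. \<chi> i. x $ p i)"
  proof (rule lborel_eqI)
    fix l u :: "real^'k"
    assume le: "\<And>b. b \<in> Basis \<Longrightarrow> l \<bullet> b \<le> u \<bullet> b"
    then have le': "l $ i \<le> u $ i" for i
      using le[of "axis i 1"] by (simp add: inner_axis axis_in_Basis_iff)
    let ?q = "\<lambda>v :: real^'k. \<chi> i. v $ inv p i"
    have "(\<lambda>x. \<chi> i. x $ p i) -` box l u = box (?q l) (?q u)"
      using permutes_inverses[OF p] by (auto simp: mem_box_cart) metis+
    moreover have "(\<Prod>i\<in>UNIV. (u - l) $ inv p i) = (\<Prod>i\<in>UNIV. (u - l) $ i)"
      using prod.permute[OF permutes_inv[OF p], of "\<lambda>i. (u - l) $ i"] by (simp add: comp_def)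
    moreover have "emeasure lborel (box (?q l) (?q u)) = ennreal (\<Prod>b\<in>Basis. (?q u - ?q l) \<bullet> b)"
      by (rule emeasure_lborel_box) (auto simp: Basis_vec_def inner_axis le')
    ultimately show "emeasure (distr lborel borel (\<lambda>x. \<chi> i. x $ p i)) (box l u)
        = (\<Prod>b\<in>Basis. (u - l) \<bullet> b)"
      by (simp add: emeasure_distr prod_Basis_vec inner_axis)
  qed simp
  then have "(\<integral>\<^sup>+x. g x \<partial>lborel) = (\<integral>\<^sup>+x. g x \<partial>distr lborel borel (\<lambda>x. \<chi> i. x $ p i))"
    by simp
  then show ?thesis
    by (simp add: nn_integral_distr)
qed

lemma sum_Basis_vec:
  fixes g :: "real^'k \<Rightarrow> 'b::comm_monoid_add"
  shows "(\<Sum>b\<in>Basis. g b) = (\<Sum>i\<in>UNIV. g (axis i 1))"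
proof -
  have "inj (\<lambda>i. axis i 1 :: real^'k)"
    by (auto intro!: injI simp: axis_eq_axis)
  moreover have "(Basis :: (real^'k) set) = range (\<lambda>i. axis i 1)"
    by (auto simp: Basis_vec_def)
  ultimately show ?thesis
    by (metis (no_types, lifting) sum.reindex_cong)
qed

lemma nn_integral_lborel_scale:
  fixes g :: "real^'k \<Rightarrow> ennreal"
  assumes [measurable]: "g \<in> borel_measurable borel" and c: "\<And>i. c i \<noteq> 0"
  shows "(\<integral>\<^sup>+x. g x \<partial>lborel) = ennreal \<bar>\<Prod>i\<in>UNIV. c i\<bar> * (\<integral>\<^sup>+x. g (\<chi> i. c i * x $ i) \<partial>lborel)"
proof -
  \<comment> \<open>The affine substitution rule takes its factors indexed by basis vectors; this
    linear functional sends \<open>axis i 1\<close> to \<open>c i\<close>.\<close>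
  define c' :: "real^'k \<Rightarrow> real" where "c' b = (\<Sum>i\<in>UNIV. b $ i * c i)" for b
  have c': "c' (axis i 1) = c i" for i
    by (simp add: c'_def axis_def if_distrib[of "\<lambda>x. x * _"] cong: if_cong)
  have T: "(\<Sum>j\<in>Basis. (c' j * (x \<bullet> j)) *\<^sub>R j) = (\<chi> i. c i * x $ i)" for x :: "real^'k"
    by (simp add: sum_Basis_vec c' inner_axis vec_eq_iff)
       (simp add: axis_def if_distrib[of "\<lambda>x. _ * x"] cong: if_cong)
  have nz: "c' j \<noteq> 0" if "j \<in> Basis" for j
    using that c by (auto simp: Basis_vec_def c')
  have "lborel = density (distr lborel borel (\<lambda>x :: real^'k. \<chi> i. c i * x $ i))
      (\<lambda>_. ennreal \<bar>\<Prod>i\<in>UNIV. c i\<bar>)"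
    using lborel_affine_euclidean[of c' 0, OF nz]
    by (simp add: T prod_Basis_vec c' abs_prod)
  then have "(\<integral>\<^sup>+x. g x \<partial>lborel) = (\<integral>\<^sup>+x. g x \<partial>density (distr lborel borel (\<lambda>x :: real^'k. \<chi> i. c i * x $ i))
      (\<lambda>_. ennreal \<bar>\<Prod>i\<in>UNIV. c i\<bar>))"
    by simp
  then show ?thesis
    by (simp add: nn_integral_density nn_integral_distr nn_integral_cmult)
qed

text \<open>Change of variables by decomposition into elementary matrices: diagonal scalings,
  transpositions of coordinates and shears were treated separately, and the formula is stable under
  products because \<open>det\<close> is multiplicative.\<close>

lemma nn_integral_lborel_matrix:
  fixes g :: "real^'k \<Rightarrow> ennreal" and B :: "real^'k^'k"
  assumes "g \<in> borel_measurable borel" and "det B \<noteq> 0"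
  shows "(\<integral>\<^sup>+x. g x \<partial>lborel) = ennreal \<bar>det B\<bar> * (\<integral>\<^sup>+x. g (B *v x) \<partial>lborel)"
proof -
  \<comment> \<open>The integrand is quantified because the product case applies the hypothesis for
    the second factor to \<open>g\<close> composed with the first. Keeping
    \<open>det B \<noteq> 0\<close> inside makes the case of a zero row vacuous.\<close>
  have "\<forall>g\<in>borel_measurable borel. det B \<noteq> 0 \<longrightarrow>
      (\<integral>\<^sup>+x. g x \<partial>lborel) = ennreal \<bar>det B\<bar> * (\<integral>\<^sup>+x. g (B *v x) \<partial>lborel)"
  proof (induction B rule: induct_matrix_elementary_alt)
    case (1 A B)
    show ?case
    proof (intro ballI impI)
      fix g :: "real^'k \<Rightarrow> ennreal"
      assume g [measurable]: "g \<in> borel_measurable borel" and "det (A ** B) \<noteq> 0"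
      then have "det A \<noteq> 0" "det B \<noteq> 0"
        by (auto simp: det_mul)
      then have "(\<integral>\<^sup>+x. g x \<partial>lborel) = ennreal \<bar>det A\<bar> * (\<integral>\<^sup>+x. g (A *v x) \<partial>lborel)"
        and "(\<integral>\<^sup>+x. g (A *v x) \<partial>lborel) = ennreal \<bar>det B\<bar> * (\<integral>\<^sup>+x. g (A *v (B *v x)) \<partial>lborel)"
        using 1(1)[rule_format, OF g] 1(2)[rule_format, of "\<lambda>x. g (A *v x)"] by auto
      then show "(\<integral>\<^sup>+x. g x \<partial>lborel)
          = ennreal \<bar>det (A ** B)\<bar> * (\<integral>\<^sup>+x. g ((A ** B) *v x) \<partial>lborel)"
        by (simp add: det_mul abs_mult ennreal_mult matrix_vector_mul_assoc mult.assoc)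
    qed
  next
    case (2 A i)
    then show ?case
      using det_zero_row(1) by blast
  next
    case (3 A)
    show ?case
    proof (intro ballI impI)
      fix g :: "real^'k \<Rightarrow> ennreal"
      assume g: "g \<in> borel_measurable borel" and "det A \<noteq> 0"
      have det: "det A = (\<Prod>i\<in>UNIV. A $ i $ i)"
        by (rule det_diagonal) (use 3 in auto)
      have "A *v x = (\<chi> i. A $ i $ i * x $ i)" for x
      proof -
        have "(\<Sum>j\<in>UNIV. A $ i $ j * x $ j) = A $ i $ i * x $ i" for i
          by (subst sum.remove[of _ i]) (use 3 in auto)
        then show ?thesis
          by (simp add: matrix_vector_mult_def)
      qed
      then show "(\<integral>\<^sup>+x. g x \<partial>lborel) = ennreal \<bar>det A\<bar> * (\<integral>\<^sup>+x. g (A *v x) \<partial>lborel)"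
        using nn_integral_lborel_scale[OF g, of "\<lambda>i. A $ i $ i"] \<open>det A \<noteq> 0\<close> det by simp
    qed
  next
    case (4 m n)
    let ?p = "Transposition.transpose m n" and ?I = "mat 1 :: real^'k^'k"
    have p: "?p permutes UNIV"
      by (simp add: permutes_swap_id)
    have det: "\<bar>det (\<chi> i j. ?I $ i $ ?p j)\<bar> = 1"
      using p by (simp add: det_permute_columns abs_mult sign_def)
    have "(\<chi> i j. ?I $ i $ ?p j) *v x = (\<chi> i. x $ ?p i)" for x :: "real^'k"
    proof -
      have "(\<Sum>j\<in>UNIV. ?I $ i $ ?p j * x $ j) = x $ ?p i" for i
      proof -
        have "?I $ i $ ?p j * x $ j = (if j = ?p i then x $ j else 0)" for j
          by (auto simp: mat_def transpose_eq_iff)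
        then show ?thesis by simp
      qed
      then show ?thesis
        by (simp add: matrix_vector_mult_def)
    qed
    then show ?case
      using nn_integral_lborel_permute[OF _ p] by (simp add: det)
  next
    case (5 m n)
    let ?B = "\<chi> i j. of_bool (i = m \<and> j = n \<or> i = j) :: real^'k^'k"
    have "?B = (\<chi> k. if k = m then row m (mat 1) + 1 *s row n (mat 1) else row k (mat 1))"
      using 5 by (auto simp: vec_eq_iff row_def mat_def)
    then have det: "det ?B = 1"
      using det_row_operation[OF 5, of "mat 1" 1] by simp
    have mv: "?B *v x = (\<chi> i. if i = m then x $ m + x $ n else x $ i)" for x :: "real^'k"
    proof -
      have "(\<Sum>j\<in>UNIV. of_bool (i = m \<and> j = n \<or> i = j) * x $ j)
          = (if i = m then x $ m + x $ n else x $ i)" for i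
      proof -
        have "of_bool (i = m \<and> j = n \<or> i = j) * x $ j
            = (if j = n then of_bool (i = m) * x $ j else 0) + (if j = i then x $ j else 0)" for j
          using 5 by auto
        then show ?thesis
          by (auto simp: sum.distrib)
      qed
      then show ?thesis
        by (simp add: matrix_vector_mult_def)
    qed
    show ?case
      unfolding mv det using nn_integral_lborel_shear[OF _ 5] by simp
  qed
  then show ?thesis
    using assms by blast
qed

section \<open>Normalisation of Gaussian densities\<close>

text \<open>Gram-Schmidt for the inner product \<open>x \<bullet> (S *v y)\<close>: the columns of
  \<open>V\<close> are an orthonormal basis for it. Determinant, inverse and quadratic form of
  \<open>S\<close> can then all be read off \<open>V\<close>.\<close>

lemma pos_def_orthonormal:
  fixes S :: "real^'k^'k"
  assumes S: "pos_def S"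
  obtains V :: "real^'k^'k" where "transpose V ** S ** V = mat 1"
proof -
  have sym: "x \<bullet> (S *v y) = y \<bullet> (S *v x)" for x y
    using S by (metis dot_lmul_matrix inner_commute pos_def_def transpose_matrix_vector)
  have "\<exists>v. \<forall>i\<in>F. \<forall>j\<in>F. v i \<bullet> (S *v v j) = (if i = j then 1 else 0)" if "finite F" for F :: "'k set"
    using that
  proof (induction F)
    case empty
    show ?case by simp
  next
    case (insert k F)
    then obtain v where v: "\<And>i j. i \<in> F \<Longrightarrow> j \<in> F \<Longrightarrow> v i \<bullet> (S *v v j) = (if i = j then 1 else 0)"
      by blast
    \<comment> \<open>Fewer than \<open>CARD('k)\<close> vectors cannot span the space, so some
      nonzero \<open>w\<close> is orthogonal to all \<open>S *v v i\<close>, that is, orthogonal to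
      all \<open>v i\<close> in the new inner product. Normalising \<open>w\<close> gives the next
      basis vector.\<close>
    have "dim ((\<lambda>i. S *v v i) ` F) \<le> card F"
      using insert.hyps by (meson card_image_le dim_le_card' finite_imageI le_trans)
    also have "\<dots> < CARD('k)"
      using insert.hyps by (intro psubset_card_mono) auto
    finally obtain w where "w \<noteq> 0" and w: "\<And>y. y \<in> span ((\<lambda>i. S *v v i) ` F) \<Longrightarrow> orthogonal w y"
      using orthogonal_to_subspace_exists[of "(\<lambda>i. S *v v i) ` F"] by auto
    have w0: "w \<bullet> (S *v v i) = 0" if "i \<in> F" for i
      using w[of "S *v v i"] that by (auto simp: orthogonal_def intro: span_base)
    have pos: "w \<bullet> (S *v w) > 0"
      using S \<open>w \<noteq> 0\<close> by (simp add: pos_def_def)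
    define u where "u = (1 / sqrt (w \<bullet> (S *v w))) *\<^sub>R w"
    have u0: "u \<bullet> (S *v v i) = 0" "v i \<bullet> (S *v u) = 0" if "i \<in> F" for i
      using w0[OF that] sym[of "v i" u] by (auto simp: u_def)
    have "u \<bullet> (S *v u) = 1"
      using pos by (simp add: u_def matrix_vector_mult_scaleR)
    with u0 v insert.hyps show ?case
      by (intro exI[of _ "v(k := u)"]) auto
  qed
  from this[of UNIV] obtain v :: "'k \<Rightarrow> real^'k" where v: "v i \<bullet> (S *v v j) = (if i = j then 1 else 0)" for i j
    by auto
  let ?V = "\<chi> r c. v c $ r"
  have "(transpose ?V ** S ** ?V) $ i $ j = v i \<bullet> (S *v v j)" for i j
    by (simp add: matrix_mul_assoc[symmetric])
       (simp add: matrix_matrix_mult_def matrix_vector_mult_def transpose_def inner_vec_def)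
  then have "transpose ?V ** S ** ?V = mat 1"
    by (simp add: vec_eq_iff v mat_def)
  then show ?thesis
    by (rule that)
qed

lemma pos_def_det_pos:
  fixes S :: "real^'k^'k"
  assumes "pos_def S"
  shows "det S > 0"
proof -
  obtain V :: "real^'k^'k" where "transpose V ** S ** V = mat 1"
    using assms by (rule pos_def_orthonormal)
  then have "det (transpose V ** S ** V) = 1"
    by simp
  then have "(det V)\<^sup>2 * det S = 1"
    by (simp add: det_mul det_transpose power2_eq_square mult_ac)
  then show ?thesis
    by (metis mult_nonneg_nonpos not_le zero_le_power2 zero_less_one)
qed

lemma pos_def_matrix_inv:
  fixes S V :: "real^'k^'k"
  assumes "transpose V ** S ** V = mat 1"
  shows "matrix_inv S = V ** transpose V"
proof -
  have "transpose V ** (S ** V) = mat 1"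
    using assms by (simp add: matrix_mul_assoc)
  then have "S ** V ** transpose V = mat 1"
    by (simp add: matrix_left_right_inverse)
  then have "S ** (V ** transpose V) = mat 1"
    by (simp add: matrix_mul_assoc)
  moreover from this have "(V ** transpose V) ** S = mat 1"
    by (simp add: matrix_left_right_inverse)
  ultimately have inv: "S ** (V ** transpose V) = mat 1 \<and> (V ** transpose V) ** S = mat 1"
    by simp
  \<comment> \<open>\<open>matrix_inv\<close> is a choice operator, so its defining property becomes
    available only through an explicit two-sided inverse.\<close>
  then have "S ** matrix_inv S = mat 1"
    unfolding matrix_inv_def by (rule someI2) simp
  then have "(V ** transpose V) ** S ** matrix_inv S = V ** transpose V"
    by (simp add: matrix_mul_assoc[symmetric])
  then show ?thesis
    using inv by simp
qed

text \<open>In the coordinates \<open>z = transpose V *v (x - \<mu>)\<close> the quadratic form of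
  the inverse covariance is the squared norm of \<open>z\<close>, and the normalising factor
  \<open>1 / sqrt (det S)\<close> is the absolute determinant of \<open>V\<close>.\<close>

lemma mvn_density_eq_prod:
  fixes S V :: "real^'k^'k"
  assumes V: "transpose V ** S ** V = mat 1"
  shows "mvn_density \<mu> S x = \<bar>det V\<bar> * (\<Prod>i\<in>UNIV. std_normal_density ((transpose V *v (x - \<mu>)) $ i))"
proof -
  define z where "z = transpose V *v (x - \<mu>)"
  have "det (transpose V ** S ** V) = 1"
    by (simp add: V)
  then have det: "(det V)\<^sup>2 * det S = 1"
    by (simp add: det_mul det_transpose power2_eq_square mult_ac)
  have "(x - \<mu>) \<bullet> (matrix_inv S *v (x - \<mu>)) = z \<bullet> z"
    by (simp add: pos_def_matrix_inv[OF V] z_def matrix_vector_mul_assoc[symmetric])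
       (metis dot_lmul_matrix matrix_transpose_mul transpose_matrix_vector transpose_transpose)
  also have "\<dots> = (\<Sum>i\<in>UNIV. (z $ i)\<^sup>2)"
    by (simp add: inner_vec_def power2_eq_square)
  finally have quad: "(x - \<mu>) \<bullet> (matrix_inv S *v (x - \<mu>)) = (\<Sum>i\<in>UNIV. (z $ i)\<^sup>2)" .
  have "sqrt (det S) = 1 / \<bar>det V\<bar>"
  proof -
    have "det V \<noteq> 0" using det by auto
    then have "det S = 1 / (det V)\<^sup>2" using det by (simp add: field_simps)
    then show ?thesis by (simp add: real_sqrt_divide)
  qed
  then have "mvn_density \<mu> S x = \<bar>det V\<bar> * (exp (- (\<Sum>i\<in>UNIV. (z $ i)\<^sup>2) / 2) / sqrt (2 * pi) ^ CARD('k))"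
    by (simp add: mvn_density_def quad real_sqrt_mult real_sqrt_power power_mult_distrib mult_ac)
  also have "exp (- (\<Sum>i\<in>UNIV. (z $ i)\<^sup>2) / 2) / sqrt (2 * pi) ^ CARD('k)
      = (\<Prod>i\<in>UNIV. std_normal_density (z $ i))"
    by (simp add: std_normal_density_def prod_dividef exp_sum[symmetric] sum_negf sum_divide_distrib)
  finally show ?thesis
    by (simp add: z_def)
qed

lemma nn_integral_prod_std_normal:
  "(\<integral>\<^sup>+x. ennreal (\<Prod>i\<in>UNIV. std_normal_density (x $ i)) \<partial>(lborel :: (real^'k) measure)) = 1"
proof -
  have "(\<integral>\<^sup>+x. ennreal (std_normal_density x) \<partial>lborel) = 1"
    using prob_space.emeasure_space_1[OF prob_space_normal_density[of 1 0]]
    by (simp add: emeasure_density)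
  then show ?thesis
    using lborel_prod.product_nn_integral_prod[of "UNIV :: 'k set" "\<lambda>_ x. ennreal (std_normal_density x)"]
    by (subst nn_integral_lborel_vec) (simp_all add: prod_ennreal[symmetric])
qed

lemma mvn_density_pos: "pos_def S \<Longrightarrow> mvn_density \<mu> S x > 0"
  by (simp add: mvn_density_def pos_def_det_pos)

text \<open>The bound is the value at the mean: the quadratic form in the exponent is a squared norm
  and hence nonnegative.\<close>

lemma mvn_density_le:
  fixes S :: "real^'k^'k"
  assumes S: "pos_def S"
  shows "mvn_density \<mu> S x \<le> 1 / sqrt ((2 * pi) ^ CARD('k) * det S)"
proof -
  obtain V :: "real^'k^'k" where V: "transpose V ** S ** V = mat 1"
    using S by (rule pos_def_orthonormal)
  have "w \<bullet> ((V ** transpose V) *v w) = (transpose V *v w) \<bullet> (transpose V *v w)" for w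
    by (simp add: matrix_vector_mul_assoc[symmetric])
       (metis dot_lmul_matrix matrix_transpose_mul transpose_matrix_vector transpose_transpose)
  then have "(x - \<mu>) \<bullet> (matrix_inv S *v (x - \<mu>)) \<ge> 0"
    by (simp add: pos_def_matrix_inv[OF V])
  then show ?thesis
    using pos_def_det_pos[OF S] by (simp add: mvn_density_def divide_right_mono)
qed

lemma borel_measurable_mvn_density [measurable (raw)]:
  fixes f g :: "'a \<Rightarrow> real^'k"
  assumes [measurable]: "f \<in> borel_measurable M" "g \<in> borel_measurable M"
  shows "(\<lambda>x. mvn_density (f x) S (g x)) \<in> borel_measurable M"
  unfolding mvn_density_def by measurable

text \<open>The factor \<open>\<bar>det V\<bar>\<close> in front of the product of standard normal
  densities is exactly the Jacobian of the substitution that produced it.\<close>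

lemma nn_integral_mvn_density:
  fixes S :: "real^'k^'k"
  assumes S: "pos_def S"
  shows "(\<integral>\<^sup>+x. ennreal (mvn_density \<mu> S x) \<partial>lborel) = 1"
proof -
  obtain V :: "real^'k^'k" where V: "transpose V ** S ** V = mat 1"
    using S by (rule pos_def_orthonormal)
  have "det (transpose V ** S ** V) = 1"
    by (simp add: V)
  then have det: "det (transpose V) \<noteq> 0"
    by (auto simp: det_mul det_transpose)
  let ?h = "\<lambda>x :: real^'k. ennreal (\<Prod>i\<in>UNIV. std_normal_density (x $ i))"
  have "(\<integral>\<^sup>+x. ennreal (mvn_density \<mu> S x) \<partial>lborel)
      = (\<integral>\<^sup>+x. ennreal \<bar>det (transpose V)\<bar> * ?h (transpose V *v (x + - \<mu>)) \<partial>lborel)"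
    by (simp add: mvn_density_eq_prod[OF V] ennreal_mult prod_nonneg det_transpose)
  also have "\<dots> = ennreal \<bar>det (transpose V)\<bar> * (\<integral>\<^sup>+x. ?h (transpose V *v x) \<partial>lborel)"
    by (subst nn_integral_lborel_add) (simp_all add: nn_integral_cmult del: transpose_matrix_vector)
  also have "\<dots> = (\<integral>\<^sup>+x. ?h x \<partial>lborel)"
    by (subst (2) nn_integral_lborel_matrix[OF _ det]) simp_all
  also have "\<dots> = 1"
    by (rule nn_integral_prod_std_normal)
  finally show ?thesis .
qed

text \<open>The quadratic form decomposes into the sum of the forms of the blocks on the slices
  \<open>b d\<close> of \<open>x\<close>, and a nonzero vector has a nonzero slice.\<close>

lemma pos_def_block_diag:
  fixes S :: "'n::finite \<Rightarrow> real^'i^'i"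
  assumes S: "\<And>d. pos_def (S d)"
  shows "pos_def (block_diag S)"
  unfolding pos_def_def
proof (intro conjI allI impI)
  have "S d $ i $ j = S d $ j $ i" for d i j
    using S[of d] by (metis (mono_tags) pos_def_def transpose_def vec_lambda_beta)
  then show "transpose (block_diag S) = block_diag S"
    by (auto simp: vec_eq_iff transpose_def block_diag_def)
next
  fix x :: "real^('n \<times> 'i)"
  assume "x \<noteq> 0"
  define b where "b d = (\<chi> i. x $ (d, i))" for d
  have "x \<bullet> (block_diag S *v x)
      = (\<Sum>d\<in>UNIV. \<Sum>i\<in>UNIV. x $ (d, i) * (\<Sum>d'\<in>UNIV. \<Sum>j\<in>UNIV. (if d = d' then S d $ i $ j else 0) * x $ (d', j)))"
    by (simp add: inner_vec_def matrix_vector_mult_def block_diag_def sum.cartesian_product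
        UNIV_Times_UNIV[symmetric] case_prod_beta del: UNIV_Times_UNIV)
  also have "\<dots> = (\<Sum>d\<in>UNIV. b d \<bullet> (S d *v b d))"
  proof -
    have "(\<Sum>d'\<in>UNIV. \<Sum>j\<in>UNIV. (if d = d' then S d $ i $ j else 0) * x $ (d', j))
        = (\<Sum>j\<in>UNIV. S d $ i $ j * x $ (d, j))" for d i
      by (subst sum.remove[of _ d]) (auto intro!: sum.neutral)
    then show ?thesis
      by (simp add: inner_vec_def matrix_vector_mult_def b_def)
  qed
  also have "\<dots> > 0"
  proof -
    obtain d i where "x $ (d, i) \<noteq> 0"
      using \<open>x \<noteq> 0\<close> by (auto simp: vec_eq_iff)
    then have "b d \<noteq> 0"
      by (auto simp: b_def vec_eq_iff)
    then have "b d \<bullet> (S d *v b d) > 0"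
      using S by (simp add: pos_def_def)
    moreover have "b d' \<bullet> (S d' *v b d') \<ge> 0" for d'
      using S[of d'] by (cases "b d' = 0") (auto simp: pos_def_def less_imp_le)
    ultimately show ?thesis
      by (intro sum_pos2[of _ d]) auto
  qed
  finally show "x \<bullet> (block_diag S *v x) > 0" .
qed

section \<open>Extended expectations and the divergence in Bayes' rule\<close>

text \<open>An upper bound on a finite measure makes the positive parts of \<open>e\<close> and of
  \<open>e - k\<close> integrable, so infinity can come only from the negative part of
  \<open>e\<close> or from \<open>k\<close>, and then both sides are minus infinity.\<close>

lemma ext_expect_diff:
  fixes e k :: "'a::euclidean_space \<Rightarrow> real"
  assumes fin: "emeasure (density_measure q) UNIV < \<infinity>"
    and e [measurable]: "e \<in> borel_measurable borel" and k [measurable]: "k \<in> borel_measurable borel"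
    and e_le: "\<And>u. e u \<le> c" and k_ge: "\<And>u. 0 \<le> k u"
  shows "ext_expect q (\<lambda>u. e u - k u) = ext_expect q e - ext_expect q k"
proof -
  define M where "M = density_measure q"
  have sets_M [measurable_cong]: "sets M = sets borel"
    by (simp add: M_def density_measure_def)
  then have space_M: "space M = UNIV"
    by (simp add: sets_eq_imp_space_eq)
  define P where "P = (\<integral>\<^sup>+u. ennreal (e u - k u) \<partial>M)"
  define N where "N = (\<integral>\<^sup>+u. ennreal (- (e u - k u)) \<partial>M)"
  define Pe where "Pe = (\<integral>\<^sup>+u. ennreal (e u) \<partial>M)"
  define Ne where "Ne = (\<integral>\<^sup>+u. ennreal (- e u) \<partial>M)"
  define K where "K = (\<integral>\<^sup>+u. ennreal (k u) \<partial>M)"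
  have "(\<integral>\<^sup>+u. ennreal (g u) \<partial>M) < \<infinity>" if "\<And>u. g u \<le> c" for g
  proof -
    have "(\<integral>\<^sup>+u. ennreal (g u) \<partial>M) \<le> (\<integral>\<^sup>+u. ennreal c \<partial>M)"
      using that by (intro nn_integral_mono ennreal_leI)
    also have "\<dots> < \<infinity>"
      using fin by (simp add: space_M M_def[symmetric] ennreal_mult_less_top)
    finally show ?thesis .
  qed
  moreover have "e u - k u \<le> c" for u
    using e_le[of u] k_ge[of u] by linarith
  ultimately have fin_P: "P < \<infinity>" and fin_Pe: "Pe < \<infinity>"
    using e_le by (auto simp: P_def Pe_def)
  \<comment> \<open>All subtractions are moved across before integrating: the pointwise identity
    between positive and negative parts has only nonnegative summands, so it integrates even where
    some terms are infinite.\<close>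
  have "P + Ne + K = (\<integral>\<^sup>+u. ennreal (e u - k u) + ennreal (- e u) + ennreal (k u) \<partial>M)"
    by (simp add: P_def Ne_def K_def nn_integral_add)
  also have "\<dots> = (\<integral>\<^sup>+u. ennreal (- (e u - k u)) + ennreal (e u) \<partial>M)"
  proof (rule nn_integral_cong)
    fix u
    show "ennreal (e u - k u) + ennreal (- e u) + ennreal (k u) = ennreal (- (e u - k u)) + ennreal (e u)"
      using k_ge[of u]
      by (cases "e u \<ge> 0"; cases "e u \<ge> k u") (simp_all add: ennreal_neg ennreal_plus[symmetric] del: ennreal_plus)
  qed
  also have "\<dots> = N + Pe"
    by (simp add: N_def Pe_def nn_integral_add)
  finally have key: "P + Ne + K = N + Pe" .
  have neg_k: "(\<integral>\<^sup>+u. ennreal (- k u) \<partial>M) = 0"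
    using k_ge by (simp add: ennreal_neg)
  have "enn2ereal P - enn2ereal N = (enn2ereal Pe - enn2ereal Ne) - enn2ereal K"
    using key fin_P fin_Pe
    by (cases P; cases Ne; cases K; cases N; cases Pe)
       (auto simp: enn2ereal_ennreal ennreal_plus[symmetric] top_ereal_def simp del: ennreal_plus)
  then show ?thesis
    by (simp add: ext_expect_def M_def[symmetric] P_def N_def Pe_def Ne_def K_def neg_k zero_ennreal.rep_eq)
qed

text \<open>The summand \<open>K\<^sup>2\<close> covers \<open>a \<ge> 1\<close>, where
  \<open>ln a \<le> a\<close>; the summand 1 covers \<open>a < 1\<close>, where the absolute
  logarithm is at most \<open>1 / a\<close>.\<close>

lemma mult_abs_ln_le:
  fixes a K :: real
  assumes "0 < a" "a \<le> K"
  shows "a * \<bar>ln a\<bar> \<le> 1 + K\<^sup>2"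
proof (cases "a \<ge> 1")
  case True
  then have "a * \<bar>ln a\<bar> \<le> a * a"
    using ln_le_minus_one[of a] by (intro mult_left_mono) auto
  also have "\<dots> \<le> K\<^sup>2"
    using assms by (simp add: power2_eq_square mult_mono)
  finally show ?thesis by simp
next
  case False
  then have "\<bar>ln a\<bar> = ln (1 / a)"
    using assms by (simp add: ln_div)
  also have "\<dots> \<le> 1 / a"
    using assms ln_le_minus_one[of "1 / a"] by simp
  finally have "a * \<bar>ln a\<bar> \<le> a * (1 / a)"
    using assms by (intro mult_left_mono) auto
  then show ?thesis
    using assms by (simp add: add_increasing2)
qed

lemma prob_space_density_measure:
  assumes "p \<in> borel_measurable borel" "(\<integral>\<^sup>+x. ennreal (p x) \<partial>lborel) = 1"
  shows "prob_space (density lborel (\<lambda>x. ennreal (p x)))"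
  using assms by (intro prob_spaceI) (simp add: emeasure_density)

text \<open>Abstract form of one Bayes step: \<open>p\<close> is the prior, \<open>a\<close> the
  likelihood function, \<open>L\<close> the evidence and \<open>f\<close> the posterior. The second
  and third conclusions supply the sign and the bound for \<open>ext_expect_diff\<close>; the fourth
  exposes the integral for the measurability argument in \<open>u\<close>.\<close>

lemma KL_bayes:
  fixes p f a :: "'a::euclidean_space \<Rightarrow> real"
  assumes p [measurable]: "p \<in> borel_measurable borel" and p0: "\<And>x. 0 \<le> p x"
    and p1: "(\<integral>\<^sup>+x. ennreal (p x) \<partial>lborel) = 1"
    and f [measurable]: "f \<in> borel_measurable borel" and f0: "\<And>x. 0 \<le> f x"
    and f1: "(\<integral>\<^sup>+x. ennreal (f x) \<partial>lborel) = 1"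
    and a [measurable]: "a \<in> borel_measurable borel" and a0: "\<And>x. 0 < a x" and aK: "\<And>x. a x \<le> K"
    and L: "0 < L" and bayes: "AE x in lborel. f x = a x * p x / L"
  shows "KL f p = expect f (\<lambda>x. ln (a x)) - ln L" (is ?eq)
    and "0 \<le> KL f p"
    and "expect f (\<lambda>x. ln (a x)) \<le> ln K"
    and "expect f (\<lambda>x. ln (a x)) = (LINT x|lborel. f x * ln (a x))"
proof -
  show exp_eq: "expect f (\<lambda>x. ln (a x)) = (LINT x|lborel. f x * ln (a x))"
    using f0 by (simp add: expect_def density_measure_def integral_density)
  have int_p: "integrable lborel p" and int_f: "integrable lborel f"
    using p0 p1 f0 f1 by (simp_all add: integrable_iff_bounded)
  have f_int1: "(LINT x|lborel. f x) = 1"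
    using f0 f1 by (simp add: integral_eq_nn_integral)
  have int: "integrable lborel (\<lambda>x. f x * ln (a x))"
  proof (rule Bochner_Integration.integrable_bound)
    show "integrable lborel (\<lambda>x. p x * ((1 + K\<^sup>2) / L))"
      using int_p by simp
    show "AE x in lborel. norm (f x * ln (a x)) \<le> norm (p x * ((1 + K\<^sup>2) / L))"
      using bayes
    proof eventually_elim
      case (elim x)
      then have "norm (f x * ln (a x)) = p x * ((a x * \<bar>ln (a x)\<bar>) / L)"
        using p0[of x] a0[of x] L by (simp add: abs_mult)
      also have "\<dots> \<le> p x * ((1 + K\<^sup>2) / L)"
        using p0[of x] L mult_abs_ln_le[OF a0 aK] by (intro mult_left_mono divide_right_mono) auto
      finally show ?case
        using p0[of x] L by simp
    qed
  qed simp
  have integrand: "AE x in lborel. f x * log (exp 1) (f x / p x) = f x * ln (a x) - ln L * f x"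
    using bayes
  proof eventually_elim
    case (elim x)
    show ?case
    \<comment> \<open>Where the prior vanishes, so does the posterior, and the factor
      \<open>f x\<close> cancels whatever value the logarithm of a division by zero has.\<close>
    proof (cases "p x = 0")
      case False
      then have "f x / p x = a x / L"
        using elim by simp
      then show ?thesis
        using a0[of x] L by (simp add: log_ln[symmetric] ln_div algebra_simps)
    qed (simp add: elim)
  qed
  have ac: "AE x in lborel. p x = 0 \<longrightarrow> f x = 0"
    using bayes by eventually_elim simp
  have "KL f p = (LINT x|lborel. f x * log (exp 1) (f x / p x))"
    unfolding KL_def density_measure_def
    using p0 f0 ac by (intro lborel.KL_density_density) auto
  also have "\<dots> = (LINT x|lborel. f x * ln (a x) - ln L * f x)"
    by (rule integral_cong_AE) (use integrand in auto)
  also have "\<dots> = expect f (\<lambda>x. ln (a x)) - ln L"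
    using int int_f by (simp add: exp_eq f_int1)
  finally show ?eq .
  show "0 \<le> KL f p"
    unfolding KL_def density_measure_def
  proof (rule lborel.KL_density_density_nonneg)
    show "integrable lborel (\<lambda>x. f x * log (exp 1) (f x / p x))"
      using int int_f
      by (subst integrable_cong_AE[OF _ _ integrand]) auto
  qed (use p0 f0 ac prob_space_density_measure[OF p p1] prob_space_density_measure[OF f f1] in auto)
  have "ln (a x) \<le> ln K" for x
    using a0[of x] aK[of x] by (simp add: ln_mono)
  then have "(LINT x|lborel. f x * ln (a x)) \<le> (LINT x|lborel. f x * ln K)"
    using int int_f f0
    by (intro integral_mono mult_left_mono) auto
  then show "expect f (\<lambda>x. ln (a x)) \<le> ln K"
    using int_f by (simp add: exp_eq f_int1)
qed

section \<open>Transition and emission densities\<close>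

text \<open>Finiteness of the double integral makes the inner integral finite off a null set, so the
  default value 0 of a divergent Bochner integral does no harm. The orders differ on purpose: with
  \<open>x\<close> as the future observations, integrating over \<open>x\<close> first collapses
  their emission factors.\<close>

lemma iterated_LINT_eq_nn_integral:
  fixes f :: "'a \<Rightarrow> 'b \<Rightarrow> real"
  assumes M: "sigma_finite_measure M" and N: "sigma_finite_measure N"
    and f [measurable]: "case_prod f \<in> borel_measurable (M \<Otimes>\<^sub>M N)"
    and nonneg: "\<And>x y. 0 \<le> f x y"
    and fin: "(\<integral>\<^sup>+y. \<integral>\<^sup>+x. ennreal (f x y) \<partial>M \<partial>N) < \<infinity>"
  shows "(LINT x|M. LINT y|N. f x y) = enn2real (\<integral>\<^sup>+y. \<integral>\<^sup>+x. ennreal (f x y) \<partial>M \<partial>N)"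
proof -
  interpret M: sigma_finite_measure M by fact
  interpret N: sigma_finite_measure N by fact
  interpret pair_sigma_finite M N ..
  have swap: "(\<integral>\<^sup>+y. \<integral>\<^sup>+x. ennreal (f x y) \<partial>M \<partial>N) = (\<integral>\<^sup>+x. \<integral>\<^sup>+y. ennreal (f x y) \<partial>N \<partial>M)"
    by (rule Fubini') simp
  have "AE x in M. (\<integral>\<^sup>+y. ennreal (f x y) \<partial>N) \<noteq> \<infinity>"
    using fin unfolding swap by (intro nn_integral_PInf_AE) auto
  then have inner: "AE x in M. ennreal (LINT y|N. f x y) = (\<integral>\<^sup>+y. ennreal (f x y) \<partial>N)"
    using AE_space
  proof eventually_elim
    case (elim x)
    have [measurable]: "f x \<in> borel_measurable N"
      using measurable_compose[OF measurable_Pair1'[OF elim(2)] f] by simp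
    show ?case
      using elim nonneg by (simp add: integral_eq_nn_integral less_top)
  qed
  have "(LINT x|M. LINT y|N. f x y) = enn2real (\<integral>\<^sup>+x. ennreal (LINT y|N. f x y) \<partial>M)"
    using nonneg by (intro integral_eq_nn_integral) auto
  then show ?thesis
    unfolding swap using nn_integral_cong_AE[OF inner] by simp
qed

definition std_normal_vec :: "('k::finite \<Rightarrow> real) measure" where
  "std_normal_vec = (\<Pi>\<^sub>M i\<in>UNIV. density lborel (\<lambda>e. ennreal (std_normal_density e)))"

lemma sets_std_normal_vec [measurable_cong]:
  "sets (std_normal_vec :: ('k::finite \<Rightarrow> real) measure) = sets (\<Pi>\<^sub>M i\<in>UNIV. borel)"
  unfolding std_normal_vec_def by (rule sets_PiM_cong) simp_all

lemma prob_space_std_normal_vec: "prob_space std_normal_vec"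
  unfolding std_normal_vec_def by (intro prob_space_PiM prob_space_normal_density) simp

text \<open>Each coordinate law is an affine image of the standard normal law, and a product of
  image measures is the image of the product, which is checked on rectangles. The underlying measure
  no longer depends on \<open>u\<close> or \<open>x\<close>, and zero variances need no separate
  case.\<close>

lemma cond_law_eq_distr:
  fixes G :: "('n::finite, 'm::finite, 'i::finite) gpssm"
  shows "cond_law G u x =
    distr std_normal_vec borel (\<lambda>e. \<chi> d. cond_mean G u x d + sqrt (cond_var G x d) * e d)"
proof -
  define N where "N = density lborel (\<lambda>e. ennreal (std_normal_density e))"
  define T where "T d e = cond_mean G u x d + sqrt (cond_var G x d) * e" for d :: 'n and e
  have T [measurable]: "T d \<in> borel_measurable borel" for d
    unfolding T_def by measurable
  have sets_N [measurable_cong]: "sets N = sets borel"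
    by (simp add: N_def)
  have space_N: "space N = UNIV"
    by (simp add: N_def)
  have prob_N: "prob_space N"
    unfolding N_def by (rule prob_space_normal_density) simp
  interpret N: product_prob_space "\<lambda>_ :: 'n. N"
    by (intro product_prob_spaceI prob_N)
  have "prob_space (distr N borel (T d))" for d
    by (intro prob_space.prob_space_distr prob_N) measurable
  then interpret D: product_prob_space "\<lambda>d. distr N borel (T d)"
    by (rule product_prob_spaceI)
  have "distr (PiM UNIV (\<lambda>_. N)) (PiM UNIV (\<lambda>_. borel)) (\<lambda>e. \<lambda>d\<in>UNIV. T d (e d))
      = PiM UNIV (\<lambda>d. distr N borel (T d))"
  proof (rule D.PiM_eqI)
    fix B :: "'n \<Rightarrow> real set"
    assume "\<And>d. d \<in> UNIV \<Longrightarrow> B d \<in> sets (distr N borel (T d))"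
    then have B [measurable]: "B d \<in> sets borel" for d
      by simp
    have "(\<lambda>e. \<lambda>d\<in>UNIV. T d (e d)) -` (\<Pi>\<^sub>E d\<in>UNIV. B d) \<inter> space (PiM UNIV (\<lambda>_. N))
        = (\<Pi>\<^sub>E d\<in>UNIV. T d -` B d \<inter> space N)"
      by (auto simp: space_PiM space_N PiE_iff)
    moreover have "T d -` B d \<inter> space N \<in> sets N" for d
      by measurable
    ultimately show "emeasure (distr (PiM UNIV (\<lambda>_. N)) (PiM UNIV (\<lambda>_. borel)) (\<lambda>e. \<lambda>d\<in>UNIV. T d (e d)))
        (Pi\<^sub>E UNIV B) = (\<Prod>d\<in>UNIV. emeasure (distr N borel (T d)) (B d))"
      by (subst emeasure_distr)
         (auto simp: N.emeasure_PiM emeasure_distr intro!: sets_PiM_I_finite)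
  qed (auto intro!: sets_PiM_cong)
  then have "cond_law G u x = distr (distr (PiM UNIV (\<lambda>_. N)) (PiM UNIV (\<lambda>_. borel)) (\<lambda>e. \<lambda>d\<in>UNIV. T d (e d)))
      borel (\<lambda>g. \<chi> d. g d)"
    by (simp add: cond_law_def normal_law_def N_def T_def[abs_def])
  also have "\<dots> = distr (PiM UNIV (\<lambda>_. N)) borel (\<lambda>e. \<chi> d. T d (e d))"
  proof -
    have "(\<lambda>e. \<lambda>d\<in>UNIV. T d (e d)) \<in> measurable (PiM UNIV (\<lambda>_. N)) (PiM UNIV (\<lambda>_. borel))"
      by measurable
    then show ?thesis
      by (subst distr_distr) (simp_all add: comp_def restrict_def)
  qed
  finally show ?thesis
    by (simp add: N_def T_def std_normal_vec_def)
qed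

text \<open>The reparametrised sample: it has law \<open>cond_law G u x\<close> when
  \<open>e\<close> is drawn from \<open>std_normal_vec\<close>.\<close>

definition trans_point ::
  "('n::finite, 'm::finite, 'i::finite) gpssm \<Rightarrow> real^('n \<times> 'i) \<Rightarrow> real^'n \<Rightarrow> ('n \<Rightarrow> real) \<Rightarrow> real^'n" where
  "trans_point G u x e = (\<chi> d. cond_mean G u x d + sqrt (cond_var G x d) * e d)"

text \<open>The height of the emission Gaussian at its mean.\<close>

definition emission_bound :: "('n::finite, 'm::finite, 'i::finite) gpssm \<Rightarrow> real" where
  "emission_bound G = 1 / sqrt ((2 * pi) ^ CARD('m) * det (emission_cov G))"

text \<open>The joint density of \<open>u\<close>, the whole state path and the first
  \<open>s\<close> observations. The transitions after time \<open>s\<close> remain, since all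
  states up to \<open>T\<close> are still arguments.\<close>

definition path_weight ::
  "('n::finite, 'm::finite, 'i::finite) gpssm \<Rightarrow> nat \<Rightarrow> nat \<Rightarrow> real^('n \<times> 'i) \<Rightarrow>
     (nat \<Rightarrow> real^'m) \<Rightarrow> (nat \<Rightarrow> real^'n) \<Rightarrow> real" where
  "path_weight G T s u y xs =
     init_density G (xs 0) * prior_u G u * (\<Prod>i=1..s. emission_density G (xs i) (y i)) *
     (\<Prod>i=1..T. trans_density G u (xs (i - 1)) (xs i))"

text \<open>The \<open>ennreal\<close>-valued \<open>path_mass\<close> and \<open>state_mass\<close> stand for \<open>marginal_y\<close> and \<open>marginal_xy\<close>:
  Tonelli's theorem applies to them without integrability conditions, while a Bochner integral
  that diverges is \<open>0\<close>. The second pair agrees only for almost every state.\<close>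

definition path_mass ::
  "('n::finite, 'm::finite, 'i::finite) gpssm \<Rightarrow> nat \<Rightarrow> nat \<Rightarrow> real^('n \<times> 'i) \<Rightarrow>
     (nat \<Rightarrow> real^'m) \<Rightarrow> ennreal" where
  "path_mass G T s u y = (\<integral>\<^sup>+xs. ennreal (path_weight G T s u y xs) \<partial>(\<Pi>\<^sub>M i\<in>{0..T}. lborel))"

definition state_mass ::
  "('n::finite, 'm::finite, 'i::finite) gpssm \<Rightarrow> nat \<Rightarrow> nat \<Rightarrow> nat \<Rightarrow> real^('n \<times> 'i) \<Rightarrow>
     (nat \<Rightarrow> real^'m) \<Rightarrow> real^'n \<Rightarrow> ennreal" where
  "state_mass G T t s u y x =
     (\<integral>\<^sup>+xs. ennreal (path_weight G T s u y (xs(t := x))) \<partial>(\<Pi>\<^sub>M i\<in>{0..T} - {t}. lborel))"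

context
  fixes G :: "('n::finite, 'm::finite, 'i::finite) gpssm"
  assumes valid: "valid_gpssm G"
begin

lemma pos_def_covs: "pos_def (trans_cov G)" "pos_def (emission_cov G)" "pos_def (init_cov G)"
  "pos_def (block_diag (Kzz G))"
  using valid by (auto simp: valid_gpssm_def intro: pos_def_block_diag)

lemma borel_measurable_kern:
  assumes [measurable]: "f \<in> borel_measurable M" "g \<in> borel_measurable M"
  shows "(\<lambda>z. kern G d (f z) (g z)) \<in> borel_measurable M"
proof -
  have "case_prod (kern G d) \<in> borel_measurable (borel \<Otimes>\<^sub>M borel)"
    using valid by (simp add: valid_gpssm_def)
  from measurable_compose[OF _ this, of "\<lambda>z. (f z, g z)" M] show ?thesis
    by simp
qed

lemma borel_measurable_cond:
  assumes [measurable]: "f \<in> borel_measurable M" "g \<in> borel_measurable M"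
  shows borel_measurable_cond_mean: "(\<lambda>z. cond_mean G (f z) (g z) d) \<in> borel_measurable M"
    and borel_measurable_cond_var: "(\<lambda>z. cond_var G (g z) d) \<in> borel_measurable M"
proof -
  note [measurable] = borel_measurable_kern
  have [measurable]: "(\<lambda>z. kzx G d (g z)) \<in> borel_measurable M"
    unfolding kzx_def by measurable
  show "(\<lambda>z. cond_mean G (f z) (g z) d) \<in> borel_measurable M"
    unfolding cond_mean_def by measurable
  show "(\<lambda>z. cond_var G (g z) d) \<in> borel_measurable M"
    unfolding cond_var_def by measurable
qed

lemma borel_measurable_trans_point [measurable (raw)]:
  assumes [measurable]: "f \<in> borel_measurable M" "g \<in> borel_measurable M"
    "h \<in> measurable M (\<Pi>\<^sub>M i\<in>UNIV. borel)"
  shows "(\<lambda>z. trans_point G (f z) (g z) (h z)) \<in> borel_measurable M"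
proof -
  note [measurable] = borel_measurable_cond_mean borel_measurable_cond_var
  have [measurable]: "(\<lambda>z. h z d) \<in> borel_measurable M" for d
    using measurable_compose[OF assms(3) measurable_component_singleton[of d UNIV]] by simp
  show ?thesis
    unfolding trans_point_def by measurable
qed

lemma trans_density_eq:
  "trans_density G u x' x = (LINT e|std_normal_vec. mvn_density (trans_point G u x' e) (trans_cov G) x)"
  unfolding trans_density_def cond_law_eq_distr trans_point_def[symmetric]
  by (subst integral_distr) auto

lemma trans_density_measurable [measurable (raw)]:
  assumes [measurable]: "f \<in> borel_measurable M" "g \<in> borel_measurable M" "h \<in> borel_measurable M"
  shows "(\<lambda>z. trans_density G (f z) (g z) (h z)) \<in> borel_measurable M"
proof -
  interpret prob_space "std_normal_vec :: ('n \<Rightarrow> real) measure"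
    by (rule prob_space_std_normal_vec)
  show ?thesis
    unfolding trans_density_eq by measurable
qed

text \<open>The integrand is bounded by \<open>mvn_density_le\<close> and the noise law is a
  probability measure, so the Bochner integral defining the transition density converges; strict
  positivity survives the averaging.\<close>

lemma ennreal_trans_density:
  "ennreal (trans_density G u x' x)
    = (\<integral>\<^sup>+e. ennreal (mvn_density (trans_point G u x' e) (trans_cov G) x) \<partial>std_normal_vec)"
  and trans_density_pos: "0 < trans_density G u x' x"
proof -
  interpret prob_space "std_normal_vec :: ('n \<Rightarrow> real) measure"
    by (rule prob_space_std_normal_vec)
  let ?m = "\<lambda>e. mvn_density (trans_point G u x' e) (trans_cov G) x"
  have pos: "0 < ?m e" for e
    by (intro mvn_density_pos pos_def_covs)
  have int: "integrable std_normal_vec ?m"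
    using pos mvn_density_le[OF pos_def_covs(1)]
    by (intro integrable_const_bound) (auto intro!: AE_I2 simp: abs_of_pos)
  then show "ennreal (trans_density G u x' x) = (\<integral>\<^sup>+e. ennreal (?m e) \<partial>std_normal_vec)"
    using pos by (simp add: trans_density_eq nn_integral_eq_integral less_imp_le)
  have "(LINT e|std_normal_vec. - ?m e) < 0"
    using int pos by (intro expectation_less) auto
  then show "0 < trans_density G u x' x"
    by (simp add: trans_density_eq)
qed

lemma nn_integral_trans_density: "(\<integral>\<^sup>+x. ennreal (trans_density G u x' x) \<partial>lborel) = 1"
proof -
  interpret P: prob_space "std_normal_vec :: ('n \<Rightarrow> real) measure"
    by (rule prob_space_std_normal_vec)
  interpret pair_sigma_finite "std_normal_vec :: ('n \<Rightarrow> real) measure" "lborel :: (real^'n) measure" ..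
  have "(\<integral>\<^sup>+x. ennreal (trans_density G u x' x) \<partial>lborel)
      = (\<integral>\<^sup>+e. \<integral>\<^sup>+x. ennreal (mvn_density (trans_point G u x' e) (trans_cov G) x) \<partial>lborel \<partial>std_normal_vec)"
    unfolding ennreal_trans_density by (rule Fubini') measurable
  then show ?thesis
    by (simp add: nn_integral_mvn_density pos_def_covs P.emeasure_space_1)
qed

lemma emission_density_pos: "0 < emission_density G x y"
  unfolding emission_density_def by (intro mvn_density_pos pos_def_covs)

lemma emission_density_le: "emission_density G x y \<le> emission_bound G"
  unfolding emission_density_def emission_bound_def by (intro mvn_density_le pos_def_covs)

lemma emission_density_measurable [measurable (raw)]:
  assumes [measurable]: "f \<in> borel_measurable M" "g \<in> borel_measurable M"
  shows "(\<lambda>z. emission_density G (f z) (g z)) \<in> borel_measurable M"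
  unfolding emission_density_def by measurable

lemma nn_integral_emission_density: "(\<integral>\<^sup>+y. ennreal (emission_density G x y) \<partial>lborel) = 1"
  unfolding emission_density_def by (intro nn_integral_mvn_density pos_def_covs)

lemma init_density_pos: "0 < init_density G x"
  unfolding init_density_def by (intro mvn_density_pos pos_def_covs)

lemma prior_u_pos: "0 < prior_u G u"
  unfolding prior_u_def by (intro mvn_density_pos pos_def_covs)


lemma init_density_measurable [measurable (raw)]:
  assumes [measurable]: "f \<in> borel_measurable M"
  shows "(\<lambda>z. init_density G (f z)) \<in> borel_measurable M"
  unfolding init_density_def by measurable

lemma prior_u_measurable [measurable (raw)]:
  assumes [measurable]: "f \<in> borel_measurable M"
  shows "(\<lambda>z. prior_u G (f z)) \<in> borel_measurable M"
  unfolding prior_u_def by measurable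

lemma nn_integral_init_density: "(\<integral>\<^sup>+x. ennreal (init_density G x) \<partial>lborel) = 1"
  unfolding init_density_def by (intro nn_integral_mvn_density pos_def_covs)

section \<open>Marginals of the joint density\<close>

lemma path_weight_pos: "0 < path_weight G T s u y xs"
  unfolding path_weight_def
  by (intro mult_pos_pos prod_pos init_density_pos prior_u_pos emission_density_pos trans_density_pos)

lemma path_weight_Suc:
  "path_weight G T (Suc s) u y xs
    = emission_density G (xs (Suc s)) (y (Suc s)) * path_weight G T s u y xs"
  by (simp add: path_weight_def)

lemma path_weight_measurable:
  assumes [measurable]: "U \<in> borel_measurable M"
    and X [measurable]: "\<And>i. i \<le> T \<Longrightarrow> (\<lambda>z. X z i) \<in> borel_measurable M" and "s \<le> T"
  shows "(\<lambda>z. path_weight G T s (U z) y (X z)) \<in> borel_measurable M"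
proof -
  have "(\<lambda>z. \<Prod>i=1..s. emission_density G (X z i) (y i)) \<in> borel_measurable M"
    using \<open>s \<le> T\<close> by (intro borel_measurable_prod emission_density_measurable X) auto
  moreover have "(\<lambda>z. \<Prod>i=1..T. trans_density G (U z) (X z (i - 1)) (X z i)) \<in> borel_measurable M"
    by (intro borel_measurable_prod trans_density_measurable X) auto
  ultimately show ?thesis
    unfolding path_weight_def by measurable
qed

lemma joint_density_observe_upto:
  assumes "s \<le> T"
  shows "joint_density G T u xs (observe_upto s y ys)
    = path_weight G T s u y xs * (\<Prod>i\<in>{s<..T}. emission_density G (xs i) (ys i))"
proof -
  have split: "{1..T} = {1..s} \<union> {s<..T}"
    using assms by auto
  have "(\<Prod>i=1..T. emission_density G (xs i) (observe_upto s y ys i))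
      = (\<Prod>i=1..s. emission_density G (xs i) (y i)) * (\<Prod>i\<in>{s<..T}. emission_density G (xs i) (ys i))"
  proof -
    have "(\<Prod>i=1..s. emission_density G (xs i) (observe_upto s y ys i)) = (\<Prod>i=1..s. emission_density G (xs i) (y i))"
      and "(\<Prod>i\<in>{s<..T}. emission_density G (xs i) (observe_upto s y ys i))
        = (\<Prod>i\<in>{s<..T}. emission_density G (xs i) (ys i))"
      by (auto intro!: prod.cong simp: observe_upto_def)
    then show ?thesis
      unfolding split by (subst prod.union_disjoint) auto
  qed
  then show ?thesis
    by (simp add: joint_density_def path_weight_def prod.distrib)
qed

lemma joint_density_nonneg: "s \<le> T \<Longrightarrow> 0 \<le> joint_density G T u xs (observe_upto s y ys)"
  by (simp add: joint_density_observe_upto prod_nonneg less_imp_le path_weight_pos emission_density_pos)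

lemma joint_density_measurable:
  assumes U: "U \<in> borel_measurable M"
    and X: "\<And>i. i \<le> T \<Longrightarrow> (\<lambda>z. X z i) \<in> borel_measurable M"
    and Y: "\<And>i. i \<in> {s<..T} \<Longrightarrow> (\<lambda>z. Y z i) \<in> borel_measurable M" and "s \<le> T"
  shows "(\<lambda>z. joint_density G T (U z) (X z) (observe_upto s y (Y z))) \<in> borel_measurable M"
  unfolding joint_density_observe_upto[OF \<open>s \<le> T\<close>]
  using \<open>s \<le> T\<close>
  by (intro borel_measurable_times path_weight_measurable borel_measurable_prod
      emission_density_measurable U X Y) auto

lemma nn_integral_joint_density:
  assumes "s \<le> T"
  shows "(\<integral>\<^sup>+ys. ennreal (joint_density G T u xs (observe_upto s y ys)) \<partial>(\<Pi>\<^sub>M i\<in>{s<..T}. lborel))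
    = ennreal (path_weight G T s u y xs)"
proof -
  have "(\<integral>\<^sup>+ys. (\<Prod>i\<in>{s<..T}. ennreal (emission_density G (xs i) (ys i))) \<partial>(\<Pi>\<^sub>M i\<in>{s<..T}. lborel)) = 1"
    by (subst lborel_prod.product_nn_integral_prod) (auto simp: nn_integral_emission_density)
  moreover have "(\<lambda>ys. \<Prod>i\<in>{s<..T}. ennreal (emission_density G (xs i) (ys i)))
      \<in> borel_measurable (\<Pi>\<^sub>M i\<in>{s<..T}. lborel)"
    by (intro borel_measurable_prod_ennreal measurable_compose[OF _ measurable_ennreal]
        emission_density_measurable) auto
  ultimately show ?thesis
    unfolding joint_density_observe_upto[OF assms]
    by (simp add: ennreal_mult path_weight_pos less_imp_le prod_nonneg emission_density_pos
        prod_ennreal[symmetric] nn_integral_cmult)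
qed

text \<open>Given \<open>u\<close>, the states form a Markov chain. Integrating out the last state
  first removes one normalised transition factor.\<close>

lemma nn_integral_chain:
  fixes n :: nat
  shows "(\<integral>\<^sup>+xs. ennreal (init_density G (xs 0) * (\<Prod>i=1..n. trans_density G u (xs (i - 1)) (xs i)))
      \<partial>(\<Pi>\<^sub>M i\<in>{0..n}. lborel)) = 1"
proof (induction n)
  case 0
  show ?case
    using lborel_prod.product_nn_integral_singleton[of "\<lambda>x. ennreal (init_density G x)" "0 :: nat"]
    by (simp add: nn_integral_init_density)
next
  case (Suc n)
  define c where "c n xs = init_density G (xs 0) * (\<Prod>i=1..n. trans_density G u (xs (i - 1)) (xs i))" 
    for n :: nat and xs :: "nat \<Rightarrow> real^'n"
  have c_pos: "0 < c n xs" for n xs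
    unfolding c_def by (intro mult_pos_pos prod_pos init_density_pos trans_density_pos)
  have [measurable]: "c n \<in> borel_measurable (\<Pi>\<^sub>M i\<in>{0..n}. lborel)" for n
    unfolding c_def
    by (intro borel_measurable_times borel_measurable_prod init_density_measurable trans_density_measurable) auto
  \<comment> \<open>The factors up to index \<open>n\<close> never read coordinate
    \<open>Suc n\<close>, so only the last transition sees the update.\<close>
  have c_Suc: "c (Suc n) (xs(Suc n := x)) = c n xs * trans_density G u (xs n) x" for xs x
  proof -
    have "(\<Prod>i=1..n. trans_density G u ((xs(Suc n := x)) (i - 1)) ((xs(Suc n := x)) i))
        = (\<Prod>i=1..n. trans_density G u (xs (i - 1)) (xs i))"
      by (intro prod.cong) auto
    then show ?thesis
      by (simp add: c_def)
  qed
  have ins: "{0..Suc n} = insert (Suc n) {0..n}"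
    by auto
  have "(\<integral>\<^sup>+xs. ennreal (c (Suc n) xs) \<partial>(\<Pi>\<^sub>M i\<in>{0..Suc n}. lborel))
      = (\<integral>\<^sup>+xs. \<integral>\<^sup>+x. ennreal (c (Suc n) (xs(Suc n := x))) \<partial>lborel \<partial>(\<Pi>\<^sub>M i\<in>{0..n}. lborel))"
    unfolding ins by (rule lborel_prod.product_nn_integral_insert) (simp_all add: ins[symmetric])
  also have "\<dots> = (\<integral>\<^sup>+xs. ennreal (c n xs) \<partial>(\<Pi>\<^sub>M i\<in>{0..n}. lborel))"
    by (simp add: c_Suc ennreal_mult c_pos less_imp_le trans_density_pos nn_integral_cmult nn_integral_trans_density)
  finally show ?case
    using Suc by (simp add: c_def)
qed

text \<open>Each of the \<open>s\<close> emission factors is at most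
  \<open>emission_bound G\<close>; what remains is the prior density of \<open>u\<close> times a
  chain of mass one.\<close>

lemma path_mass_finite: "s \<le> T \<Longrightarrow> path_mass G T s u y < \<infinity>"
proof -
  assume "s \<le> T"
  let ?c = "\<lambda>xs. init_density G (xs 0) * (\<Prod>i=1..T. trans_density G u (xs (i - 1)) (xs i))"
  let ?b = "prior_u G u * emission_bound G ^ s"
  have c_pos: "0 < ?c xs" for xs
    by (intro mult_pos_pos prod_pos init_density_pos trans_density_pos)
  have "0 < emission_bound G"
    using less_le_trans[OF emission_density_pos emission_density_le] .
  then have b_nonneg: "0 \<le> ?b"
    using prior_u_pos[of u] by simp
  have "path_weight G T s u y xs \<le> ?b * ?c xs" for xs
  proof -
    have "(\<Prod>i=1..s. emission_density G (xs i) (y i)) \<le> (\<Prod>i=1..s. emission_bound G)"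
      by (intro prod_mono) (auto simp: emission_density_le emission_density_pos less_imp_le)
    then have "(prior_u G u * ?c xs) * (\<Prod>i=1..s. emission_density G (xs i) (y i))
        \<le> (prior_u G u * ?c xs) * emission_bound G ^ s"
      by (intro mult_left_mono mult_nonneg_nonneg less_imp_le[OF prior_u_pos] less_imp_le[OF c_pos]) simp
    then show ?thesis
      by (simp add: path_weight_def mult_ac)
  qed
  then have "path_mass G T s u y \<le> (\<integral>\<^sup>+xs. ennreal ?b * ennreal (?c xs) \<partial>(\<Pi>\<^sub>M i\<in>{0..T}. lborel))"
    unfolding path_mass_def using b_nonneg c_pos
    by (intro nn_integral_mono) (simp add: ennreal_mult'[symmetric] ennreal_leI)
  also have "\<dots> = ennreal ?b * (\<integral>\<^sup>+xs. ennreal (?c xs) \<partial>(\<Pi>\<^sub>M i\<in>{0..T}. lborel))"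
    by (intro nn_integral_cmult measurable_compose[OF _ measurable_ennreal] borel_measurable_times
        borel_measurable_prod init_density_measurable trans_density_measurable) auto
  also have "\<dots> < \<infinity>"
    unfolding nn_integral_chain by simp
  finally show ?thesis .
qed

lemma path_weight_measurable_PiM:
  "s \<le> T \<Longrightarrow> path_weight G T s u y \<in> borel_measurable (\<Pi>\<^sub>M i\<in>{0..T}. lborel)"
  by (rule path_weight_measurable) auto

text \<open>If the mass vanished, so would almost every path weight, and then also the mass without observations.\<close>

lemma path_mass_pos:
  assumes "s \<le> T"
  shows "0 < path_mass G T s u y"
proof (rule ccontr)
  assume "\<not> 0 < path_mass G T s u y"
  then have "AE xs in \<Pi>\<^sub>M i\<in>{0..T}. lborel. ennreal (path_weight G T s u y xs) = 0"
    unfolding path_mass_def using path_weight_measurable_PiM[OF assms]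
    by (subst (asm) not_gr_zero, subst (asm) nn_integral_0_iff_AE) auto
  then have "AE xs in \<Pi>\<^sub>M i\<in>{0..T}. lborel. ennreal (init_density G (xs 0) *
      (\<Prod>i=1..T. trans_density G u (xs (i - 1)) (xs i))) = 0"
    by eventually_elim (metis path_weight_pos ennreal_eq_0_iff not_le)
  then have "(\<integral>\<^sup>+xs. ennreal (init_density G (xs 0) * (\<Prod>i=1..T. trans_density G u (xs (i - 1)) (xs i)))
      \<partial>(\<Pi>\<^sub>M i\<in>{0..T}. lborel)) = 0"
    by (subst nn_integral_cong_AE[where v = "\<lambda>_. 0"]) auto
  then show False
    unfolding nn_integral_chain by simp
qed

section \<open>Identification of the Bochner marginals with the extended masses\<close>

lemma marginal_y_eq:
  assumes "s \<le> T"
  shows "marginal_y G T s u y = enn2real (path_mass G T s u y)"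
proof -
  have "case_prod (\<lambda>ys xs. joint_density G T u xs (observe_upto s y ys))
      \<in> borel_measurable ((\<Pi>\<^sub>M i\<in>{s<..T}. lborel) \<Otimes>\<^sub>M (\<Pi>\<^sub>M i\<in>{0..T}. lborel))"
    unfolding case_prod_beta using assms by (intro joint_density_measurable) auto
  then show ?thesis
    unfolding marginal_y_def path_mass_def nn_integral_joint_density[OF assms, symmetric]
    using path_mass_finite[OF assms]
    by (intro iterated_LINT_eq_nn_integral lborel_prod.sigma_finite joint_density_nonneg[OF assms])
       (auto simp: path_mass_def nn_integral_joint_density[OF assms])
qed

lemma nn_integral_state_mass:
  assumes "s \<le> T" "t \<le> T"
  shows "(\<integral>\<^sup>+x. state_mass G T t s u y x \<partial>lborel) = path_mass G T s u y"
proof -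
  have ins: "insert t ({0..T} - {t}) = {0..T}"
    using assms by auto
  have "(\<lambda>xs. ennreal (path_weight G T s u y xs)) \<in> borel_measurable (\<Pi>\<^sub>M i\<in>{0..T}. lborel)"
    using path_weight_measurable_PiM[OF assms(1)] by (rule measurable_compose) simp
  then show ?thesis
    unfolding state_mass_def path_mass_def
    by (subst (2) ins[symmetric], subst lborel_prod.product_nn_integral_insert_rev) (simp_all only: ins, simp_all)
qed

lemma upd_component_measurable:
  fixes i t T :: nat
  assumes "f \<in> borel_measurable M" "h \<in> measurable M (\<Pi>\<^sub>M i\<in>{0..T} - {t}. lborel)" "i \<le> T"
  shows "(\<lambda>z. ((h z)(t := f z)) i) \<in> borel_measurable M"
proof (cases "i = t")
  case False
  then have "(\<lambda>z. h z i) \<in> measurable M lborel"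
    using assms by (intro measurable_compose[OF assms(2) measurable_component_singleton]) auto
  then show ?thesis
    using False by simp
qed (use assms in simp)

lemma state_mass_measurable:
  assumes [measurable]: "f \<in> borel_measurable M" "g \<in> borel_measurable M" and "s \<le> T"
  shows "(\<lambda>z. state_mass G T t s (f z) y (g z)) \<in> borel_measurable M"
proof -
  interpret sigma_finite_measure "\<Pi>\<^sub>M i\<in>{0..T} - {t}. lborel :: (real^'n) measure"
    by (rule lborel_prod.sigma_finite) simp
  show ?thesis
    unfolding state_mass_def
  proof (intro borel_measurable_nn_integral)
    show "(\<lambda>(z, xs). ennreal (path_weight G T s (f z) y (xs(t := g z))))
        \<in> borel_measurable (M \<Otimes>\<^sub>M (\<Pi>\<^sub>M i\<in>{0..T} - {t}. lborel))"
      unfolding case_prod_beta using \<open>s \<le> T\<close>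
      by (intro measurable_compose[OF _ measurable_ennreal] path_weight_measurable upd_component_measurable) auto
  qed
qed

text \<open>The index \<open>t\<close> selects a coordinate to split off: the mass becomes an
  integral of \<open>state_mass\<close>, which is jointly measurable in \<open>u\<close> and the
  state.\<close>

lemma path_mass_measurable:
  assumes "s \<le> T" "t \<le> T"
  shows "(\<lambda>u. path_mass G T s u y) \<in> borel_measurable borel"
  unfolding nn_integral_state_mass[OF assms, symmetric]
  using assms by (intro lborel.borel_measurable_nn_integral) (simp add: split_beta' state_mass_measurable)

lemma marginal_xy_measurable:
  assumes "s \<le> T"
  shows "marginal_xy G T t s u y \<in> borel_measurable borel"
proof -
  interpret X: sigma_finite_measure "\<Pi>\<^sub>M i\<in>{0..T} - {t}. lborel :: (real^'n) measure"
    by (rule lborel_prod.sigma_finite) simp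
  interpret Y: sigma_finite_measure "\<Pi>\<^sub>M i\<in>{s<..T}. lborel :: (real^'m) measure"
    by (rule lborel_prod.sigma_finite) simp
  show ?thesis
    unfolding marginal_xy_def
    using assms
    by (intro Y.borel_measurable_lebesgue_integral X.borel_measurable_lebesgue_integral)
       (auto simp: split_beta' intro!: Y.borel_measurable_lebesgue_integral X.borel_measurable_lebesgue_integral
        joint_density_measurable upd_component_measurable)
qed

text \<open>Passing to Bochner integrals needs \<open>state_mass\<close> to be finite. This is
  inferred from its finite integral \<open>path_mass\<close>, hence the exceptional null
  set.\<close>

lemma marginal_xy_eq:
  assumes "s \<le> T" "t \<le> T"
  shows "AE x in lborel. marginal_xy G T t s u y x = enn2real (state_mass G T t s u y x)"
proof -
  have "AE x in lborel. state_mass G T t s u y x \<noteq> \<infinity>"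
    using path_mass_finite[OF assms(1), of u y] assms
    by (intro nn_integral_PInf_AE) (auto simp: nn_integral_state_mass state_mass_measurable)
  then show ?thesis
  proof eventually_elim
    case (elim x)
    have "case_prod (\<lambda>ys xs. joint_density G T u (xs(t := x)) (observe_upto s y ys))
        \<in> borel_measurable ((\<Pi>\<^sub>M i\<in>{s<..T}. lborel) \<Otimes>\<^sub>M (\<Pi>\<^sub>M i\<in>{0..T} - {t}. lborel))"
      unfolding case_prod_beta using assms
      by (intro joint_density_measurable upd_component_measurable) auto
    then show ?case
      unfolding marginal_xy_def state_mass_def nn_integral_joint_density[OF assms(1), symmetric]
      using elim
      by (intro iterated_LINT_eq_nn_integral lborel_prod.sigma_finite joint_density_nonneg[OF assms(1)])
         (auto simp: state_mass_def nn_integral_joint_density[OF assms(1)] less_top)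
  qed
qed

lemma marginal_xy_nonneg: "s \<le> T \<Longrightarrow> 0 \<le> marginal_xy G T t s u y x"
  unfolding marginal_xy_def by (intro Bochner_Integration.integral_nonneg joint_density_nonneg)

text \<open>The new emission factor reads the path only at \<open>Suc s\<close>, where it is held at
  \<open>x\<close>, so it leaves the integral. This is Bayes' rule before normalisation.\<close>

lemma state_mass_Suc:
  assumes "Suc s \<le> T"
  shows "state_mass G T (Suc s) (Suc s) u y x
    = ennreal (emission_density G x (y (Suc s))) * state_mass G T (Suc s) s u y x"
proof -
  have "(\<lambda>xs. ennreal (path_weight G T s u y (xs(Suc s := x))))
      \<in> borel_measurable (\<Pi>\<^sub>M i\<in>{0..T} - {Suc s}. lborel)"
    using assms
    by (intro measurable_compose[OF _ measurable_ennreal] path_weight_measurable upd_component_measurable) auto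
  then show ?thesis
    by (simp add: state_mass_def path_weight_Suc ennreal_mult path_weight_pos emission_density_pos
        less_imp_le nn_integral_cmult)
qed

section \<open>Conditional state densities and Bayes' rule\<close>

lemma state_density_measurable:
  "s \<le> T \<Longrightarrow> state_density G T t s u y \<in> borel_measurable borel"
  unfolding state_density_def by (intro borel_measurable_divide marginal_xy_measurable) auto

lemma marginal_y_pos: "s \<le> T \<Longrightarrow> 0 < marginal_y G T s u y"
  using path_mass_pos[of s T u y] path_mass_finite[of s T u y]
  by (simp add: marginal_y_eq enn2real_positive_iff)

lemma state_density_nonneg: "s \<le> T \<Longrightarrow> 0 \<le> state_density G T t s u y x"
  unfolding state_density_def
  by (intro divide_nonneg_pos marginal_xy_nonneg marginal_y_pos)

lemma state_density_eq:
  assumes "s \<le> T" "t \<le> T"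
  shows "AE x in lborel. state_density G T t s u y x
    = enn2real (state_mass G T t s u y x) / enn2real (path_mass G T s u y)"
  using marginal_xy_eq[OF assms, of u y]
  by eventually_elim (simp add: state_density_def marginal_y_eq assms)

lemma nn_integral_state_density:
  assumes "s \<le> T" "t \<le> T"
  shows "(\<integral>\<^sup>+x. ennreal (state_density G T t s u y x) \<partial>lborel) = 1"
proof -
  let ?c = "marginal_y G T s u y"
  have c: "0 < ?c" "ennreal ?c = path_mass G T s u y"
    using marginal_y_pos path_mass_finite assms by (simp_all add: marginal_y_eq)
  have "AE x in lborel. state_mass G T t s u y x \<noteq> \<infinity>"
    using path_mass_finite[OF assms(1), of u y] assms
    by (intro nn_integral_PInf_AE) (auto simp: nn_integral_state_mass state_mass_measurable)
  then have "AE x in lborel. ennreal (state_density G T t s u y x) = state_mass G T t s u y x / ennreal ?c"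
    using marginal_xy_eq[OF assms, of u y]
  proof eventually_elim
    case (elim x)
    then show ?case
      using c(1) by (simp add: state_density_def divide_ennreal[symmetric] less_top)
  qed
  then have "(\<integral>\<^sup>+x. ennreal (state_density G T t s u y x) \<partial>lborel)
      = (\<integral>\<^sup>+x. state_mass G T t s u y x / ennreal ?c \<partial>lborel)"
    by (rule nn_integral_cong_AE)
  also have "\<dots> = path_mass G T s u y / ennreal ?c"
    using assms by (simp add: nn_integral_divide state_mass_measurable nn_integral_state_mass)
  also have "\<dots> = 1"
    using c(1) by (simp add: c(2)[symmetric] ennreal_divide_self)
  finally show ?thesis .
qed

lemma likelihood_pos: "t \<le> T \<Longrightarrow> 0 < likelihood G T t u y"
  unfolding likelihood_def by (intro divide_pos_pos marginal_y_pos) auto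

lemma filtering_eq:
  assumes "1 \<le> t" "t \<le> T"
  shows "AE x in lborel. filtering G T t u y x
    = emission_density G x (y t) * prediction G T t u y x / likelihood G T t u y"
proof -
  \<comment> \<open>For \<open>t = 0\<close> the truncated \<open>t - 1\<close> would make the
    prediction coincide with the filtering density.\<close>
  obtain s where t: "t = Suc s"
    using assms by (cases t) auto
  have s: "s \<le> T"
    using assms t by simp
  have pos: "0 < marginal_y G T s u y"
    using s by (rule marginal_y_pos)
  show ?thesis
    using marginal_xy_eq[OF assms(2) assms(2), of u y] marginal_xy_eq[OF s assms(2), of u y]
  proof eventually_elim
    case (elim x)
    have "marginal_xy G T t t u y x = emission_density G x (y t) * marginal_xy G T t s u y x"
      using elim assms emission_density_pos[of x "y t"]
      by (simp add: t state_mass_Suc enn2real_mult less_imp_le)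
    then show ?case
      \<comment> \<open>The likelihood is the quotient of the two normalising constants, so the one
        up to time \<open>s\<close> cancels.\<close>
      using pos by (simp add: filtering_def prediction_def likelihood_def state_density_def t)
  qed
qed

section \<open>Filtering and prediction\<close>

context
  fixes T t :: nat and y :: "nat \<Rightarrow> real^'m"
  assumes t: "1 \<le> t" "t \<le> T"
begin

text \<open>The instance of \<open>KL_bayes\<close> with the prediction as prior, the filtering
  density as posterior, \<open>emission_bound G\<close> as \<open>K\<close> and the predictive
  likelihood as \<open>L\<close>.\<close>

lemma filtering_KL:
  shows ln_likelihood_eq: "ln (likelihood G T t u y) =
      expect (filtering G T t u y) (\<lambda>x. ln (emission_density G x (y t)))
      - KL (filtering G T t u y) (prediction G T t u y)"
    and KL_filtering_nonneg: "0 \<le> KL (filtering G T t u y) (prediction G T t u y)"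
    and expect_filtering_le: "expect (filtering G T t u y) (\<lambda>x. ln (emission_density G x (y t)))
      \<le> ln (emission_bound G)"
    and expect_filtering_eq: "expect (filtering G T t u y) (\<lambda>x. ln (emission_density G x (y t)))
      = (LINT x|lborel. filtering G T t u y x * ln (emission_density G x (y t)))"
proof -
  have s: "t - 1 \<le> T"
    using t by simp
  have p: "prediction G T t u y \<in> borel_measurable borel" "\<And>x. 0 \<le> prediction G T t u y x"
    "(\<integral>\<^sup>+x. ennreal (prediction G T t u y x) \<partial>lborel) = 1"
    unfolding prediction_def
    using s t by (auto intro: state_density_measurable state_density_nonneg nn_integral_state_density)
  have f: "filtering G T t u y \<in> borel_measurable borel" "\<And>x. 0 \<le> filtering G T t u y x"
    "(\<integral>\<^sup>+x. ennreal (filtering G T t u y x) \<partial>lborel) = 1"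
    unfolding filtering_def
    using t by (auto intro: state_density_measurable state_density_nonneg nn_integral_state_density)
  have a: "(\<lambda>x. emission_density G x (y t)) \<in> borel_measurable borel"
    by measurable
  note bayes = KL_bayes[OF p f a emission_density_pos emission_density_le likelihood_pos[OF t(2)]
      filtering_eq[OF t]]
  show "ln (likelihood G T t u y) = expect (filtering G T t u y) (\<lambda>x. ln (emission_density G x (y t)))
      - KL (filtering G T t u y) (prediction G T t u y)"
    using bayes(1) by simp
  show "0 \<le> KL (filtering G T t u y) (prediction G T t u y)"
    by (rule bayes(2))
  show "expect (filtering G T t u y) (\<lambda>x. ln (emission_density G x (y t))) \<le> ln (emission_bound G)"
    by (rule bayes(3))
  show "expect (filtering G T t u y) (\<lambda>x. ln (emission_density G x (y t)))
      = (LINT x|lborel. filtering G T t u y x * ln (emission_density G x (y t)))"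
    by (rule bayes(4))
qed

text \<open>For each \<open>u\<close> the filtering density may be replaced, off a null set of
  states, by the quotient of masses, which is jointly measurable in \<open>u\<close> and
  \<open>x\<close>; the parameter integral is then measurable.\<close>

lemma expect_filtering_measurable:
  "(\<lambda>u. expect (filtering G T t u y) (\<lambda>x. ln (emission_density G x (y t)))) \<in> borel_measurable borel"
proof -
  let ?f = "\<lambda>u x. enn2real (state_mass G T t t u y x) / enn2real (path_mass G T t u y)"
  have "expect (filtering G T t u y) (\<lambda>x. ln (emission_density G x (y t)))
      = (LINT x|lborel. ?f u x * ln (emission_density G x (y t)))" for u
  proof -
    have [measurable]: "filtering G T t u y \<in> borel_measurable borel"
      "state_mass G T t t u y \<in> borel_measurable borel"
      using t unfolding filtering_def by (auto intro: state_density_measurable state_mass_measurable)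
    have "AE x in lborel. filtering G T t u y x * ln (emission_density G x (y t))
        = ?f u x * ln (emission_density G x (y t))"
      using state_density_eq[OF t(2) t(2), of u y] unfolding filtering_def by eventually_elim simp
    then show ?thesis
      unfolding expect_filtering_eq by (rule integral_cong_AE[rotated 2]) measurable
  qed
  moreover have "(\<lambda>u. LINT x|lborel. ?f u x * ln (emission_density G x (y t))) \<in> borel_measurable borel"
  proof -
    have [measurable]: "(\<lambda>z. state_mass G T t t (fst z) y (snd z)) \<in> borel_measurable (borel \<Otimes>\<^sub>M lborel)"
      using t by (intro state_mass_measurable) auto
    have [measurable]: "(\<lambda>u. path_mass G T t u y) \<in> borel_measurable borel"
      using t by (intro path_mass_measurable) auto
    show ?thesis
      by (intro lborel.borel_measurable_lebesgue_integral) (simp add: split_beta')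
  qed
  ultimately show ?thesis
    by simp
qed

text \<open>Solving the first identity for the divergence leaves only the reconstruction term and
  the logarithm of a quotient of masses, both measurable in \<open>u\<close>.\<close>

lemma KL_filtering_measurable:
  "(\<lambda>u. KL (filtering G T t u y) (prediction G T t u y)) \<in> borel_measurable borel"
proof -
  have [measurable]: "(\<lambda>u. path_mass G T (t - 1) u y) \<in> borel_measurable borel"
    "(\<lambda>u. path_mass G T t u y) \<in> borel_measurable borel"
    using t by (auto intro!: path_mass_measurable)
  note expect_filtering_measurable [measurable]
  have "KL (filtering G T t u y) (prediction G T t u y)
      = expect (filtering G T t u y) (\<lambda>x. ln (emission_density G x (y t)))
        - ln (enn2real (path_mass G T t u y) / enn2real (path_mass G T (t - 1) u y))" for u
    using ln_likelihood_eq[of u] t by (simp add: likelihood_def marginal_y_eq)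
  moreover have "(\<lambda>u. expect (filtering G T t u y) (\<lambda>x. ln (emission_density G x (y t)))
        - ln (enn2real (path_mass G T t u y) / enn2real (path_mass G T (t - 1) u y))) \<in> borel_measurable borel"
    by measurable
  ultimately show ?thesis
    by simp
qed

end

end

theorem proposition2:
  fixes G :: "('n::finite, 'm::finite, 'i::finite) gpssm"
    and T t :: nat
    and y :: "nat \<Rightarrow> real^'m"
    and m :: "real^('n \<times> 'i)"
    and S :: "'n \<Rightarrow> real^'i^'i"
    and q :: "real^('n \<times> 'i) \<Rightarrow> real"
  assumes "valid_gpssm G"
    and "1 \<le> t" and "t \<le> T"
    and "\<forall>d. pos_def (S d)"
    and "q = mvn_density m (block_diag S)"
  shows "(\<forall>u. ln (likelihood G T t u y) =
            - KL (filtering G T t u y) (prediction G T t u y)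
            + expect (filtering G T t u y) (\<lambda>x. ln (emission_density G x (y t))))
       \<and> online_objective G T t q y =
            ext_expect q (\<lambda>u. expect (filtering G T t u y) (\<lambda>x. ln (emission_density G x (y t))))
            - ext_expect q (\<lambda>u. KL (filtering G T t u y) (prediction G T t u y))
            - ereal (KL q (prior_u G))"
proof (intro conjI allI)
  note valid = \<open>valid_gpssm G\<close> and t = \<open>1 \<le> t\<close> \<open>t \<le> T\<close>
  let ?e = "\<lambda>u. expect (filtering G T t u y) (\<lambda>x. ln (emission_density G x (y t)))"
  let ?k = "\<lambda>u. KL (filtering G T t u y) (prediction G T t u y)"
  show "ln (likelihood G T t u y) = - ?k u + ?e u" for u
    using ln_likelihood_eq[OF valid t] by simp
  have "pos_def (block_diag S)"
    using \<open>\<forall>d. pos_def (S d)\<close> by (intro pos_def_block_diag) auto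
  then have "emeasure (density_measure q) UNIV = 1"
    unfolding \<open>q = mvn_density m (block_diag S)\<close> density_measure_def
    by (simp add: emeasure_density nn_integral_mvn_density)
  then have "emeasure (density_measure q) UNIV < \<infinity>"
    by simp
  \<comment> \<open>The bound \<open>ln (emission_bound G)\<close> on the reconstruction term is
    uniform in \<open>u\<close> and serves as the constant \<open>c\<close> of
    \<open>ext_expect_diff\<close>.\<close>
  then have "ext_expect q (\<lambda>u. ?e u - ?k u) = ext_expect q ?e - ext_expect q ?k"
    by (rule ext_expect_diff[OF _ expect_filtering_measurable[OF valid t] KL_filtering_measurable[OF valid t]
          expect_filtering_le[OF valid t] KL_filtering_nonneg[OF valid t]])
  then show "online_objective G T t q y = ext_expect q ?e - ext_expect q ?k - ereal (KL q (prior_u G))"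
    by (simp add: online_objective_def ln_likelihood_eq[OF valid t])
qed

end
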